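(* Let $\mathcal A$ be a locally small abelian category with enough projectives. If $\mathcal T^n(\mathcal A)=\mathcal T^{n+1}(\mathcal A)$ for some $n\ge1$, then $\mathcal T^n(\mathcal A)=\mathcal T^\infty(\mathcal A)$ and $\mathcal A$ is weakly Gorenstein.
   Context: $\mathcal P(\mathcal A)$ is the full subcategory of projectives and ${}^{\perp}\mathcal P(\mathcal A)=\{X\in\mathcal A\mid \mathrm{Ext}^i_{\mathcal A}(X,P)=0\text{ for all }i\ge1,\ P\in\mathcal P(\mathcal A)\}$. A morphism $f:M\to P$ with $P$ projective is a left projective approximation if every morphism from $M$ to a projective object factors through $f$. For $n\ge1$, $M$ is $n$-torsionfree if there is an exact sequence $0\to M\xrightarrow{f_1}P_1\xrightarrow{f_2}\cdots\xrightarrow{f_n}P_n$ with all $P_i$ projective such that each inclusion $\mathrm{Im} f_i\to P_i$ is a left projective approximation ($1\le i\le n$); $\mathcal T^n(\mathcal A)$ is the full subcategory of such objects and $\mathcal T^\infty(\mathcal A)=\bigcap_{n\ge1}\mathcal T^n(\mathcal A)$. An object is Gorenstein projective if it is isomorphic to the zeroth cocycle of a totally acyclic complex, i.e. of an acyclic complex of projectives, unbounded in both directions, that remains acyclic after applying $\mathrm{Hom}_{\mathcal A}(-,P)$ for every projective $P$; $\mathrm{GP}(\mathcal A)$ is the full subcategory of these objects. $\mathcal A$ is weakly Gorenstein if $\mathrm{GP}(\mathcal A)={}^{\perp}\mathcal P(\mathcal A)$. *)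

theory Defs
  imports "HOL-Algebra.Elementary_Groups"
begin

section \<open>Abelian categories\<close>

text \<open>
  A category is given by a set of objects and a set of arrows with domain and codomain; since the
  arrows form a set, local smallness holds automatically. The additive structure on the sets
  of homomorphisms is part of the data (for an abelian category it is uniquely determined).
\<close>

record ('o, 'm) addcat =
  Ob    :: "'o set"
  Arr   :: "'m set"
  Dom   :: "'m \<Rightarrow> 'o"
  Cod   :: "'m \<Rightarrow> 'o"
  Ident :: "'o \<Rightarrow> 'm"
  Comp  :: "'m \<Rightarrow> 'm \<Rightarrow> 'm"  (infixr \<open>\<cdot>\<index>\<close> 70)
  Add   :: "'m \<Rightarrow> 'm \<Rightarrow> 'm"
  Zero  :: "'o \<Rightarrow> 'o \<Rightarrow> 'm"

definition Hom :: "('o, 'm) addcat \<Rightarrow> 'o \<Rightarrow> 'o \<Rightarrow> 'm set" where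
  "Hom C X Y = {f \<in> Arr C. Dom C f = X \<and> Cod C f = Y}"

text \<open>The additive group of arrows from \<open>X\<close> to \<open>Y\<close>, in the multiplicative notation of HOL-Algebra.\<close>

definition hom_group :: "('o, 'm) addcat \<Rightarrow> 'o \<Rightarrow> 'o \<Rightarrow> 'm monoid" where
  "hom_group C X Y = \<lparr>carrier = Hom C X Y, mult = Add C, one = Zero C X Y\<rparr>"

definition monic :: "('o, 'm) addcat \<Rightarrow> 'm \<Rightarrow> bool" where
  "monic C f \<longleftrightarrow> f \<in> Arr C \<and>
     (\<forall>W. \<forall>g \<in> Hom C W (Dom C f). \<forall>h \<in> Hom C W (Dom C f).
        f \<cdot>\<^bsub>C\<^esub> g = f \<cdot>\<^bsub>C\<^esub> h \<longrightarrow> g = h)"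

definition epic :: "('o, 'm) addcat \<Rightarrow> 'm \<Rightarrow> bool" where
  "epic C f \<longleftrightarrow> f \<in> Arr C \<and>
     (\<forall>W. \<forall>g \<in> Hom C (Cod C f) W. \<forall>h \<in> Hom C (Cod C f) W.
        g \<cdot>\<^bsub>C\<^esub> f = h \<cdot>\<^bsub>C\<^esub> f \<longrightarrow> g = h)"

definition isomorphic :: "('o, 'm) addcat \<Rightarrow> 'o \<Rightarrow> 'o \<Rightarrow> bool" where
  "isomorphic C X Y \<longleftrightarrow>
     (\<exists>f \<in> Hom C X Y. \<exists>g \<in> Hom C Y X. g \<cdot>\<^bsub>C\<^esub> f = Ident C X \<and> f \<cdot>\<^bsub>C\<^esub> g = Ident C Y)"

definition zero_object :: "('o, 'm) addcat \<Rightarrow> 'o \<Rightarrow> bool" where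
  "zero_object C Z \<longleftrightarrow> Z \<in> Ob C \<and>
     (\<forall>X \<in> Ob C. (\<exists>!f. f \<in> Hom C X Z) \<and> (\<exists>!f. f \<in> Hom C Z X))"

definition is_kernel :: "('o, 'm) addcat \<Rightarrow> 'm \<Rightarrow> 'm \<Rightarrow> bool" where
  "is_kernel C k f \<longleftrightarrow> k \<in> Arr C \<and> f \<in> Arr C \<and> Cod C k = Dom C f \<and>
     f \<cdot>\<^bsub>C\<^esub> k = Zero C (Dom C k) (Cod C f) \<and>
     (\<forall>W. \<forall>h \<in> Hom C W (Dom C f). f \<cdot>\<^bsub>C\<^esub> h = Zero C W (Cod C f) \<longrightarrow>
        (\<exists>!u. u \<in> Hom C W (Dom C k) \<and> k \<cdot>\<^bsub>C\<^esub> u = h))"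

definition is_cokernel :: "('o, 'm) addcat \<Rightarrow> 'm \<Rightarrow> 'm \<Rightarrow> bool" where
  "is_cokernel C c f \<longleftrightarrow> c \<in> Arr C \<and> f \<in> Arr C \<and> Dom C c = Cod C f \<and>
     c \<cdot>\<^bsub>C\<^esub> f = Zero C (Dom C f) (Cod C c) \<and>
     (\<forall>W. \<forall>h \<in> Hom C (Cod C f) W. h \<cdot>\<^bsub>C\<^esub> f = Zero C (Dom C f) W \<longrightarrow>
        (\<exists>!u. u \<in> Hom C (Cod C c) W \<and> u \<cdot>\<^bsub>C\<^esub> c = h))"

locale category =
  fixes C :: "('o, 'm) addcat" (structure)
  assumes dom_closed: "f \<in> Arr C \<Longrightarrow> Dom C f \<in> Ob C"
    and cod_closed: "f \<in> Arr C \<Longrightarrow> Cod C f \<in> Ob C"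
    and ident_closed: "X \<in> Ob C \<Longrightarrow> Ident C X \<in> Hom C X X"
    and comp_closed: "\<lbrakk>f \<in> Hom C X Y; g \<in> Hom C Y Z\<rbrakk> \<Longrightarrow> g \<cdot> f \<in> Hom C X Z"
    and comp_ident_left: "f \<in> Hom C X Y \<Longrightarrow> Ident C Y \<cdot> f = f"
    and comp_ident_right: "f \<in> Hom C X Y \<Longrightarrow> f \<cdot> Ident C X = f"
    and comp_assoc: "\<lbrakk>f \<in> Hom C W X; g \<in> Hom C X Y; h \<in> Hom C Y Z\<rbrakk>
                       \<Longrightarrow> (h \<cdot> g) \<cdot> f = h \<cdot> (g \<cdot> f)"

locale preadditive_category = category +
  assumes hom_comm_group: "\<lbrakk>X \<in> Ob C; Y \<in> Ob C\<rbrakk> \<Longrightarrow> comm_group (hom_group C X Y)"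
    and comp_add_left: "\<lbrakk>f \<in> Hom C X Y; g \<in> Hom C Y Z; h \<in> Hom C Y Z\<rbrakk>
                          \<Longrightarrow> Add C g h \<cdot> f = Add C (g \<cdot> f) (h \<cdot> f)"
    and comp_add_right: "\<lbrakk>f \<in> Hom C X Y; g \<in> Hom C X Y; h \<in> Hom C Y Z\<rbrakk>
                          \<Longrightarrow> h \<cdot> Add C f g = Add C (h \<cdot> f) (h \<cdot> g)"

locale additive_category = preadditive_category +
  assumes ex_zero_object: "\<exists>Z. zero_object C Z"
    and ex_biproduct: "\<lbrakk>X \<in> Ob C; Y \<in> Ob C\<rbrakk> \<Longrightarrow>
          \<exists>S. \<exists>i \<in> Hom C X S. \<exists>j \<in> Hom C Y S. \<exists>p \<in> Hom C S X. \<exists>q \<in> Hom C S Y.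
            p \<cdot> i = Ident C X \<and> q \<cdot> j = Ident C Y \<and> Add C (i \<cdot> p) (j \<cdot> q) = Ident C S"

locale abelian_category = additive_category +
  assumes ex_kernel: "f \<in> Arr C \<Longrightarrow> \<exists>k. is_kernel C k f"
    and ex_cokernel: "f \<in> Arr C \<Longrightarrow> \<exists>c. is_cokernel C c f"
    and monic_normal: "monic C f \<Longrightarrow> \<exists>g. is_kernel C f g"
    and epic_normal: "epic C f \<Longrightarrow> \<exists>g. is_cokernel C f g"


section \<open>Exactness and projective objects\<close>

text \<open>\<open>is_image C m f\<close>: the arrow \<open>m\<close> is (the inclusion of) an image of \<open>f\<close>, the kernel of a cokernel.\<close>

definition is_image :: "('o, 'm) addcat \<Rightarrow> 'm \<Rightarrow> 'm \<Rightarrow> bool" where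
  "is_image C m f \<longleftrightarrow> (\<exists>c. is_cokernel C c f \<and> is_kernel C m c)"

text \<open>Exactness of \<open>X \<rightarrow> Y \<rightarrow> Z\<close> at \<open>Y\<close>: the image of \<open>f\<close> is the kernel of \<open>g\<close>, as subobjects of \<open>Y\<close>.\<close>

definition exact :: "('o, 'm) addcat \<Rightarrow> 'm \<Rightarrow> 'm \<Rightarrow> bool" where
  "exact C f g \<longleftrightarrow> (\<exists>m. is_image C m f \<and> is_kernel C m g)"

definition projective :: "('o, 'm) addcat \<Rightarrow> 'o \<Rightarrow> bool" where
  "projective C P \<longleftrightarrow> P \<in> Ob C \<and>
     (\<forall>e. epic C e \<longrightarrow> (\<forall>f \<in> Hom C P (Cod C e). \<exists>g \<in> Hom C P (Dom C e). e \<cdot>\<^bsub>C\<^esub> g = f))"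

definition enough_projectives :: "('o, 'm) addcat \<Rightarrow> bool" where
  "enough_projectives C \<longleftrightarrow>
     (\<forall>X \<in> Ob C. \<exists>P e. projective C P \<and> e \<in> Hom C P X \<and> epic C e)"


section \<open>Ext groups\<close>

text \<open>
  The data \<open>(P, d, e)\<close> stands for the sequence
  \<open>\<dots> \<rightarrow> P 2 \<rightarrow> P 1 \<rightarrow> P 0 \<rightarrow> X \<rightarrow> 0\<close> with differentials \<open>d i : P (i + 1) \<rightarrow> P i\<close> and
  augmentation \<open>e : P 0 \<rightarrow> X\<close>.
\<close>

definition projective_resolution ::
    "('o, 'm) addcat \<Rightarrow> 'o \<Rightarrow> (nat \<Rightarrow> 'o) \<times> (nat \<Rightarrow> 'm) \<times> 'm \<Rightarrow> bool" where
  "projective_resolution C X = (\<lambda>(P, d, e).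
     (\<forall>i. projective C (P i)) \<and>
     e \<in> Hom C (P 0) X \<and>
     (\<forall>i. d i \<in> Hom C (P (Suc i)) (P i)) \<and>
     (\<exists>Z. zero_object C Z \<and> exact C e (Zero C X Z)) \<and>
     exact C (d 0) e \<and>
     (\<forall>i. exact C (d (Suc i)) (d i)))"

text \<open>The cohomology groups of the complex \<open>0 \<rightarrow> Hom(P 0, Y) \<rightarrow> Hom(P 1, Y) \<rightarrow> \<dots>\<close>.\<close>

definition hom_cocycles ::
    "('o, 'm) addcat \<Rightarrow> (nat \<Rightarrow> 'o) \<Rightarrow> (nat \<Rightarrow> 'm) \<Rightarrow> 'o \<Rightarrow> nat \<Rightarrow> 'm set" where
  "hom_cocycles C P d Y i =
     kernel (hom_group C (P i) Y) (hom_group C (P (Suc i)) Y) (\<lambda>f. f \<cdot>\<^bsub>C\<^esub> d i)"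

definition hom_coboundaries ::
    "('o, 'm) addcat \<Rightarrow> (nat \<Rightarrow> 'o) \<Rightarrow> (nat \<Rightarrow> 'm) \<Rightarrow> 'o \<Rightarrow> nat \<Rightarrow> 'm set" where
  "hom_coboundaries C P d Y i =
     (case i of 0 \<Rightarrow> {Zero C (P 0) Y} | Suc j \<Rightarrow> (\<lambda>f. f \<cdot>\<^bsub>C\<^esub> d j) ` Hom C (P j) Y)"

definition hom_cohomology ::
    "('o, 'm) addcat \<Rightarrow> (nat \<Rightarrow> 'o) \<Rightarrow> (nat \<Rightarrow> 'm) \<Rightarrow> 'o \<Rightarrow> nat \<Rightarrow> 'm set monoid" where
  "hom_cohomology C P d Y i =
     (hom_group C (P i) Y)\<lparr>carrier := hom_cocycles C P d Y i\<rparr> Mod hom_coboundaries C P d Y i"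

text \<open>
  \<open>Ext C i X Y\<close> is computed from an arbitrary but fixed projective resolution of \<open>X\<close> (which exists
  if there are enough projectives); up to isomorphism it does not depend on that choice.
\<close>

definition Ext :: "('o, 'm) addcat \<Rightarrow> nat \<Rightarrow> 'o \<Rightarrow> 'o \<Rightarrow> 'm set monoid" where
  "Ext C i X Y =
     (case (SOME R. projective_resolution C X R) of (P, d, e) \<Rightarrow> hom_cohomology C P d Y i)"

definition left_perp_projectives :: "('o, 'm) addcat \<Rightarrow> 'o set" where
  "left_perp_projectives C =
     {X \<in> Ob C. \<forall>i \<ge> 1. \<forall>P. projective C P \<longrightarrow> trivial_group (Ext C i X P)}"


section \<open>Torsionfree and Gorenstein projective objects\<close>

definition left_projective_approximation :: "('o, 'm) addcat \<Rightarrow> 'm \<Rightarrow> bool" where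
  "left_projective_approximation C f \<longleftrightarrow> f \<in> Arr C \<and> projective C (Cod C f) \<and>
     (\<forall>Q. projective C Q \<longrightarrow>
        (\<forall>g \<in> Hom C (Dom C f) Q. \<exists>h \<in> Hom C (Cod C f) Q. h \<cdot>\<^bsub>C\<^esub> f = g))"

text \<open>
  In the exact sequence \<open>0 \<rightarrow> M \<rightarrow> P 1 \<rightarrow> \<dots> \<rightarrow> P n\<close> we write \<open>M = P 0\<close>, so that
  \<open>f i : P (i - 1) \<rightarrow> P i\<close>. Nothing is required at the last term \<open>P n\<close>.
\<close>

definition torsionfree :: "('o, 'm) addcat \<Rightarrow> nat \<Rightarrow> 'o \<Rightarrow> bool" where
  "torsionfree C n M \<longleftrightarrow> M \<in> Ob C \<and>
     (\<exists>(P :: nat \<Rightarrow> 'o) (f :: nat \<Rightarrow> 'm).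
        P 0 = M \<and>
        (\<forall>i \<in> {1..n}. projective C (P i)) \<and>
        (\<forall>i \<in> {1..n}. f i \<in> Hom C (P (i - 1)) (P i)) \<and>
        (\<exists>Z. zero_object C Z \<and> exact C (Zero C Z M) (f 1)) \<and>
        (\<forall>i \<in> {1..<n}. exact C (f i) (f (Suc i))) \<and>
        (\<forall>i \<in> {1..n}. \<forall>m. is_image C m (f i) \<longrightarrow> left_projective_approximation C m))"

text \<open>The classes \<open>torsionfree_objects C n\<close> are meant for \<open>n \<ge> 1\<close> only.\<close>

definition torsionfree_objects :: "('o, 'm) addcat \<Rightarrow> nat \<Rightarrow> 'o set" where
  "torsionfree_objects C n = {M. torsionfree C n M}"

definition inf_torsionfree_objects :: "('o, 'm) addcat \<Rightarrow> 'o set" where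
  "inf_torsionfree_objects C = (\<Inter>n \<in> {1..}. torsionfree_objects C n)"

definition totally_acyclic :: "('o, 'm) addcat \<Rightarrow> (int \<Rightarrow> 'o) \<Rightarrow> (int \<Rightarrow> 'm) \<Rightarrow> bool" where
  "totally_acyclic C P d \<longleftrightarrow>
     (\<forall>i. projective C (P i)) \<and>
     (\<forall>i. d i \<in> Hom C (P i) (P (i + 1))) \<and>
     (\<forall>i. exact C (d i) (d (i + 1))) \<and>
     (\<forall>Q i. projective C Q \<longrightarrow>
        (\<lambda>f. f \<cdot>\<^bsub>C\<^esub> d (i + 1)) ` Hom C (P (i + 2)) Q =
        kernel (hom_group C (P (i + 1)) Q) (hom_group C (P i) Q) (\<lambda>f. f \<cdot>\<^bsub>C\<^esub> d i))"

definition gorenstein_projectives :: "('o, 'm) addcat \<Rightarrow> 'o set" where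
  "gorenstein_projectives C =
     {M \<in> Ob C. \<exists>P d k. totally_acyclic C P d \<and> is_kernel C k (d 0) \<and> isomorphic C M (Dom C k)}"

definition weakly_gorenstein :: "('o, 'm) addcat \<Rightarrow> bool" where
  "weakly_gorenstein C \<longleftrightarrow> gorenstein_projectives C = left_perp_projectives C"

end

theory Submission
  imports Defs
begin

text \<open>
  Write \<open>K \<leadsto> X\<close> for a short exact sequence \<open>0 \<rightarrow> K \<rightarrow> P \<rightarrow> X \<rightarrow> 0\<close> with \<open>P\<close> projective whose
  first map is a left projective approximation. Then \<open>M\<close> is \<open>n\<close>-torsionfree iff it starts a chain of
  \<open>n\<close> steps, \<open>M\<close> is Gorenstein projective iff it is isomorphic to a term of a chain unbounded in both
  directions, and \<open>X\<close> lies in the left orthogonal of the projectives iff the syzygies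
  \<open>\<dots>, K 2, K 1, K 0 = X\<close> of a projective resolution form a chain ending in \<open>X\<close>. The relation
  ``direct summand up to projective summands'' is preserved when passing along \<open>\<leadsto>\<close> in either
  direction, so it does not matter which approximations or resolutions are chosen.

  If every \<open>n\<close>-torsionfree object is \<open>(n + 1)\<close>-torsionfree, each of them starts an infinite chain of
  \<open>n\<close>-torsionfree objects. For \<open>X\<close> in the left orthogonal the syzygy \<open>K n\<close> is \<open>n\<close>-torsionfree, hence
  \<open>2n\<close>-torsionfree, and comparing the first \<open>n\<close> steps of its chain with \<open>K n \<leadsto> \<dots> \<leadsto> X\<close> shows that \<open>X\<close> is
  a stable retract of an \<open>n\<close>-torsionfree object. So \<open>X\<close> is itself \<open>n\<close>-torsionfree, and its infinite
  chain to the right, glued to the syzygies on the left, makes it Gorenstein projective.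
\<close>

section \<open>Kernels, cokernels and images\<close>

lemma in_Hom: "f \<in> Hom C X Y \<longleftrightarrow> f \<in> Arr C \<and> Dom C f = X \<and> Cod C f = Y"
  by (auto simp: Hom_def)

section \<open>Arrows, monos and epis in a plain category\<close>

context category
begin

lemma Dom_Ob [simp]: "f \<in> Arr C \<Longrightarrow> Dom C f \<in> Ob C"
  by (rule dom_closed)

lemma Cod_Ob [simp]: "f \<in> Arr C \<Longrightarrow> Cod C f \<in> Ob C"
  by (rule cod_closed)

lemma Ident_simps [simp]:
  assumes "X \<in> Ob C"
  shows "Ident C X \<in> Arr C" "Dom C (Ident C X) = X" "Cod C (Ident C X) = X"
  using ident_closed[OF assms] by (auto simp: in_Hom)

lemma comp_simps [simp]:
  assumes "f \<in> Arr C" "g \<in> Arr C" "Cod C f = Dom C g"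
  shows "g \<cdot> f \<in> Arr C" "Dom C (g \<cdot> f) = Dom C f" "Cod C (g \<cdot> f) = Cod C g"
  using comp_closed[of f "Dom C f" "Dom C g" g "Cod C g"] assms by (auto simp: in_Hom)

lemma comp_Ident [simp]:
  assumes "f \<in> Arr C"
  shows "Cod C f = Y \<Longrightarrow> Ident C Y \<cdot> f = f" "Dom C f = X \<Longrightarrow> f \<cdot> Ident C X = f"
  using comp_ident_left[of f "Dom C f" "Cod C f"] comp_ident_right[of f "Dom C f" "Cod C f"] assms
  by (auto simp: in_Hom)

lemma assoc:
  assumes "f \<in> Arr C" "g \<in> Arr C" "h \<in> Arr C" "Cod C f = Dom C g" "Cod C g = Dom C h"
  shows "(h \<cdot> g) \<cdot> f = h \<cdot> (g \<cdot> f)"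
  using comp_assoc[of f "Dom C f" "Dom C g" g "Dom C h" h "Cod C h"] assms by (auto simp: in_Hom)

lemma monic_cancel:
  assumes "monic C f" "f \<cdot> g = f \<cdot> h" "g \<in> Arr C" "h \<in> Arr C"
    "Dom C g = Dom C h" "Cod C g = Dom C f" "Cod C h = Dom C f"
  shows "g = h"
  using assms by (auto simp: monic_def in_Hom)

lemma epic_cancel:
  assumes "epic C f" "g \<cdot> f = h \<cdot> f" "g \<in> Arr C" "h \<in> Arr C"
    "Cod C g = Cod C h" "Dom C g = Cod C f" "Dom C h = Cod C f"
  shows "g = h"
  using assms by (auto simp: epic_def in_Hom)

lemma monic_Arr: "monic C f \<Longrightarrow> f \<in> Arr C"
  by (auto simp: monic_def)

lemma epic_Arr: "epic C f \<Longrightarrow> f \<in> Arr C"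
  by (auto simp: epic_def)

lemma epic_comp:
  assumes "epic C f" "epic C g" "Cod C f = Dom C g"
  shows "epic C (g \<cdot> f)"
  unfolding epic_def
proof (intro conjI allI ballI impI)
  note [simp] = assms(3) epic_Arr[OF assms(1)] epic_Arr[OF assms(2)]
  show "g \<cdot> f \<in> Arr C" by simp
  fix W a b assume "a \<in> Hom C (Cod C (g \<cdot> f)) W" "b \<in> Hom C (Cod C (g \<cdot> f)) W"
    and eq: "a \<cdot> (g \<cdot> f) = b \<cdot> (g \<cdot> f)"
  then have [simp]: "a \<in> Arr C" "b \<in> Arr C" "Dom C a = Cod C g" "Dom C b = Cod C g"
      "Cod C a = W" "Cod C b = W"
    by (auto simp: in_Hom)
  have "(a \<cdot> g) \<cdot> f = (b \<cdot> g) \<cdot> f" using eq by (simp add: assoc)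
  then have "a \<cdot> g = b \<cdot> g" by (rule epic_cancel[OF assms(1)]) simp_all
  then show "a = b" by (rule epic_cancel[OF assms(2)]) simp_all
qed

lemma split_epic:
  assumes "f \<in> Hom C X Y" "g \<in> Hom C Y X" "f \<cdot> g = Ident C Y"
  shows "epic C f"
  unfolding epic_def
proof (intro conjI allI ballI impI)
  show "f \<in> Arr C" using assms by (simp add: in_Hom)
  fix W a b assume *: "a \<in> Hom C (Cod C f) W" "b \<in> Hom C (Cod C f) W" "a \<cdot> f = b \<cdot> f"
  have "x = (x \<cdot> f) \<cdot> g" if "x \<in> Hom C (Cod C f) W" for x
    using that assms by (simp add: in_Hom assoc)
  then show "a = b" using * by metis
qed

lemma Ident_epic: "X \<in> Ob C \<Longrightarrow> epic C (Ident C X)"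
  by (rule split_epic[of _ X X "Ident C X"]) (auto simp: in_Hom)

end

section \<open>Arithmetic of arrows, kernels and cokernels in a preadditive category\<close>

context preadditive_category
begin

lemma hom_group:
  assumes "X \<in> Ob C" "Y \<in> Ob C"
  shows "group (hom_group C X Y)"
  using hom_comm_group[OF assms] by (rule comm_group.axioms(2))

lemmas hom_monoid = hom_group[THEN group.is_monoid]

lemma hom_group_simps:
  "carrier (hom_group C X Y) = Hom C X Y" "mult (hom_group C X Y) = Add C"
  "one (hom_group C X Y) = Zero C X Y"
  by (simp_all add: hom_group_def)

lemma Zero_simps [simp]:
  assumes "X \<in> Ob C" "Y \<in> Ob C"
  shows "Zero C X Y \<in> Arr C" "Dom C (Zero C X Y) = X" "Cod C (Zero C X Y) = Y"
  using monoid.one_closed[OF hom_monoid[OF assms]] by (auto simp: hom_group_simps in_Hom)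

lemma Add_simps [simp]:
  assumes "f \<in> Arr C" "g \<in> Arr C" "Dom C f = Dom C g" "Cod C f = Cod C g"
  shows "Add C f g \<in> Arr C" "Dom C (Add C f g) = Dom C g" "Cod C (Add C f g) = Cod C g"
  using monoid.m_closed[OF hom_monoid, of "Dom C g" "Cod C g" f g] assms
  by (auto simp: hom_group_simps in_Hom)

lemma Add_Zero:
  assumes "f \<in> Arr C" "Dom C f = X" "Cod C f = Y"
  shows "Add C (Zero C X Y) f = f" "Add C f (Zero C X Y) = f"
  using monoid.l_one[OF hom_monoid, of X Y f] monoid.r_one[OF hom_monoid, of X Y f] assms
  by (auto simp: hom_group_simps in_Hom)

lemma Add_cancel:
  assumes "Add C f g = Add C f h" "f \<in> Arr C" "g \<in> Arr C" "h \<in> Arr C" "Dom C f = Dom C g"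
    "Cod C f = Cod C g" "Dom C h = Dom C g" "Cod C h = Cod C g"
  shows "g = h"
proof -
  note G = hom_group[of "Dom C g" "Cod C g"]
  have "f \<in> Units (hom_group C (Dom C g) (Cod C g))"
    using assms group.Units_eq[OF G] by (simp add: hom_group_simps in_Hom)
  from monoid.Units_l_cancel[OF group.is_monoid[OF G] this, of g h]
  have "Add C f g = Add C f h \<longleftrightarrow> g = h"
    using assms(2-) by (simp add: hom_group_simps in_Hom)
  then show ?thesis using assms(1) by blast
qed

text \<open>The record \<open>addcat\<close> carries no negation; the arrow \<open>r\<close>
  obtained here plays the role of the difference of \<open>g\<close> and \<open>f\<close>.\<close>

lemma Add_solve:
  assumes "f \<in> Arr C" "g \<in> Arr C" "Dom C f = Dom C g" "Cod C f = Cod C g"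
  obtains r where "r \<in> Arr C" "Dom C r = Dom C g" "Cod C r = Cod C g" "Add C f r = g"
proof -
  let ?G = "hom_group C (Dom C g) (Cod C g)"
  have G: "group ?G" by (rule hom_group) (use assms in auto)
  have f: "f \<in> carrier ?G" and g: "g \<in> carrier ?G"
    using assms by (auto simp: hom_group_simps in_Hom)
  have i: "inv\<^bsub>?G\<^esub> f \<in> carrier ?G" by (rule group.inv_closed[OF G f])
  have "f \<otimes>\<^bsub>?G\<^esub> (inv\<^bsub>?G\<^esub> f \<otimes>\<^bsub>?G\<^esub> g) = g"
    unfolding monoid.m_assoc[OF group.is_monoid[OF G] f i g, symmetric] group.r_inv[OF G f]
    by (rule monoid.l_one[OF group.is_monoid[OF G] g])
  moreover have "inv\<^bsub>?G\<^esub> f \<otimes>\<^bsub>?G\<^esub> g \<in> carrier ?G"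
    by (rule monoid.m_closed[OF group.is_monoid[OF G] i g])
  ultimately show ?thesis using that by (auto simp: hom_group_simps in_Hom)
qed

lemma distrib_left:
  assumes "f \<in> Arr C" "g \<in> Arr C" "h \<in> Arr C" "Dom C f = Dom C g" "Cod C f = Cod C g" "Dom C h = Cod C g"
  shows "h \<cdot> Add C f g = Add C (h \<cdot> f) (h \<cdot> g)"
  using comp_add_right[of f "Dom C g" "Cod C g" g h] assms by (auto simp: in_Hom)

lemma distrib_right:
  assumes "f \<in> Arr C" "g \<in> Arr C" "h \<in> Arr C" "Dom C f = Dom C g" "Cod C f = Cod C g" "Cod C h = Dom C g"
  shows "Add C f g \<cdot> h = Add C (f \<cdot> h) (g \<cdot> h)"
  using comp_add_left[of h _ "Dom C g" f "Cod C g" g] assms by (auto simp: in_Hom)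

lemma comp_Zero [simp]:
  assumes "f \<in> Arr C" "W \<in> Ob C"
  shows "Dom C f = X \<Longrightarrow> f \<cdot> Zero C W X = Zero C W (Cod C f)"
    "Cod C f = Y \<Longrightarrow> Zero C Y W \<cdot> f = Zero C (Dom C f) W"
proof -
  have "Add C (f \<cdot> Zero C W (Dom C f)) (f \<cdot> Zero C W (Dom C f))
      = f \<cdot> Add C (Zero C W (Dom C f)) (Zero C W (Dom C f))"
    using assms by (intro distrib_left[symmetric]) simp_all
  also have "\<dots> = Add C (f \<cdot> Zero C W (Dom C f)) (Zero C W (Cod C f))"
    using assms by (simp add: Add_Zero)
  finally have "f \<cdot> Zero C W (Dom C f) = Zero C W (Cod C f)"
    by (rule Add_cancel) (use assms in auto)
  then show "Dom C f = X \<Longrightarrow> f \<cdot> Zero C W X = Zero C W (Cod C f)" by auto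
  have "Add C (Zero C (Cod C f) W \<cdot> f) (Zero C (Cod C f) W \<cdot> f)
      = Add C (Zero C (Cod C f) W) (Zero C (Cod C f) W) \<cdot> f"
    using assms by (intro distrib_right[symmetric]) simp_all
  also have "\<dots> = Add C (Zero C (Cod C f) W \<cdot> f) (Zero C (Dom C f) W)"
    using assms by (simp add: Add_Zero)
  finally have "Zero C (Cod C f) W \<cdot> f = Zero C (Dom C f) W"
    by (rule Add_cancel) (use assms in auto)
  then show "Cod C f = Y \<Longrightarrow> Zero C Y W \<cdot> f = Zero C (Dom C f) W" by auto
qed

lemma monic_Zero:
  assumes "monic C f" "f \<cdot> g = Zero C X Y" "g \<in> Arr C" "Cod C g = Dom C f" "Dom C g = X" "Cod C f = Y"
  shows "g = Zero C X (Dom C f)"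
proof (rule monic_cancel[OF assms(1)])
  have [simp]: "f \<in> Arr C" "X \<in> Ob C" using monic_Arr[OF assms(1)] assms(3,5) Dom_Ob[of g] by auto
  show "f \<cdot> g = f \<cdot> Zero C X (Dom C f)" using assms by simp
qed (use assms monic_Arr[OF assms(1)] Dom_Ob[of g] in auto)

lemma epic_Zero:
  assumes "epic C f" "g \<cdot> f = Zero C X Y" "g \<in> Arr C" "Dom C g = Cod C f" "Dom C f = X" "Cod C g = Y"
  shows "g = Zero C (Cod C f) Y"
proof (rule epic_cancel[OF assms(1)])
  have [simp]: "f \<in> Arr C" "Y \<in> Ob C" using epic_Arr[OF assms(1)] assms(3,6) Cod_Ob[of g] by auto
  show "g \<cdot> f = Zero C (Cod C f) Y \<cdot> f" using assms by simp
qed (use assms epic_Arr[OF assms(1)] Cod_Ob[of g] in auto)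

text \<open>By additivity it suffices to test against zero: an arrow that identifies
  \<open>g\<close> and \<open>h\<close> annihilates their difference.\<close>

lemma monicI:
  assumes "f \<in> Arr C"
    and "\<And>g. \<lbrakk>g \<in> Arr C; Cod C g = Dom C f; f \<cdot> g = Zero C (Dom C g) (Cod C f)\<rbrakk>
           \<Longrightarrow> g = Zero C (Dom C g) (Dom C f)"
  shows "monic C f"
  unfolding monic_def
proof (intro conjI allI ballI impI)
  fix W g h assume "g \<in> Hom C W (Dom C f)" "h \<in> Hom C W (Dom C f)" and eq: "f \<cdot> g = f \<cdot> h"
  then have [simp]: "g \<in> Arr C" "h \<in> Arr C" "Dom C g = W" "Dom C h = W"
      "Cod C g = Dom C f" "Cod C h = Dom C f" "f \<in> Arr C" "W \<in> Ob C"
    using assms(1) Dom_Ob[of g] by (auto simp: in_Hom)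
  obtain r where r [simp]: "r \<in> Arr C" "Dom C r = W" "Cod C r = Dom C f" "Add C h r = g"
    by (rule Add_solve[of h g]) simp_all
  have "Add C (f \<cdot> h) (f \<cdot> r) = f \<cdot> Add C h r" by (rule distrib_left[symmetric]) simp_all
  also have "\<dots> = Add C (f \<cdot> h) (Zero C W (Cod C f))" by (simp add: eq Add_Zero)
  finally have "f \<cdot> r = Zero C W (Cod C f)" by (rule Add_cancel) simp_all
  then have "r = Zero C W (Dom C f)" using assms(2)[of r] by simp
  then show "g = h" using r(4) by (simp add: Add_Zero)
qed (rule assms)

lemma epicI:
  assumes "f \<in> Arr C"
    and "\<And>g. \<lbrakk>g \<in> Arr C; Dom C g = Cod C f; g \<cdot> f = Zero C (Dom C f) (Cod C g)\<rbrakk>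
           \<Longrightarrow> g = Zero C (Cod C f) (Cod C g)"
  shows "epic C f"
  unfolding epic_def
proof (intro conjI allI ballI impI)
  fix W g h assume "g \<in> Hom C (Cod C f) W" "h \<in> Hom C (Cod C f) W" and eq: "g \<cdot> f = h \<cdot> f"
  then have [simp]: "g \<in> Arr C" "h \<in> Arr C" "Cod C g = W" "Cod C h = W"
      "Dom C g = Cod C f" "Dom C h = Cod C f" "f \<in> Arr C" "W \<in> Ob C"
    using assms(1) Cod_Ob[of g] by (auto simp: in_Hom)
  obtain r where r [simp]: "r \<in> Arr C" "Dom C r = Cod C f" "Cod C r = W" "Add C h r = g"
    by (rule Add_solve[of h g]) simp_all
  have "Add C (h \<cdot> f) (r \<cdot> f) = Add C h r \<cdot> f" by (rule distrib_right[symmetric]) simp_all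
  also have "\<dots> = Add C (h \<cdot> f) (Zero C (Dom C f) W)" by (simp add: eq Add_Zero)
  finally have "r \<cdot> f = Zero C (Dom C f) W" by (rule Add_cancel) simp_all
  then have "r = Zero C (Cod C f) W" using assms(2)[of r] by simp
  then show "g = h" using r(4) by (simp add: Add_Zero)
qed (rule assms)

lemma kernel_simps:
  assumes "is_kernel C k f"
  shows "k \<in> Arr C" "f \<in> Arr C" "Cod C k = Dom C f" "f \<cdot> k = Zero C (Dom C k) (Cod C f)"
  using assms by (auto simp: is_kernel_def)

lemma cokernel_simps:
  assumes "is_cokernel C c f"
  shows "c \<in> Arr C" "f \<in> Arr C" "Dom C c = Cod C f" "c \<cdot> f = Zero C (Dom C f) (Cod C c)"
  using assms by (auto simp: is_cokernel_def)

lemma kernel_ex_factor: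
  assumes "is_kernel C k f" "h \<in> Arr C" "Cod C h = Dom C f" "f \<cdot> h = Zero C (Dom C h) (Cod C f)"
  shows "\<exists>u. u \<in> Arr C \<and> Dom C u = Dom C h \<and> Cod C u = Dom C k \<and> k \<cdot> u = h"
proof -
  have "h \<in> Hom C (Dom C h) (Dom C f)" using assms by (simp add: in_Hom)
  then obtain u where "u \<in> Hom C (Dom C h) (Dom C k)" "k \<cdot> u = h"
    using assms(1,4) unfolding is_kernel_def by metis
  then show ?thesis by (auto simp: in_Hom)
qed

lemma cokernel_ex_factor:
  assumes "is_cokernel C c f" "h \<in> Arr C" "Dom C h = Cod C f" "h \<cdot> f = Zero C (Dom C f) (Cod C h)"
  shows "\<exists>u. u \<in> Arr C \<and> Dom C u = Cod C c \<and> Cod C u = Cod C h \<and> u \<cdot> c = h"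
proof -
  have "h \<in> Hom C (Cod C f) (Cod C h)" using assms by (simp add: in_Hom)
  then obtain u where "u \<in> Hom C (Cod C c) (Cod C h)" "u \<cdot> c = h"
    using assms(1,4) unfolding is_cokernel_def by metis
  then show ?thesis by (auto simp: in_Hom)
qed

lemma kernel_factor:
  assumes "is_kernel C k f" "h \<in> Arr C" "Cod C h = Dom C f" "f \<cdot> h = Zero C (Dom C h) (Cod C f)"
  obtains u where "u \<in> Arr C" "Dom C u = Dom C h" "Cod C u = Dom C k" "k \<cdot> u = h"
  using kernel_ex_factor[OF assms] by blast

lemma cokernel_factor:
  assumes "is_cokernel C c f" "h \<in> Arr C" "Dom C h = Cod C f" "h \<cdot> f = Zero C (Dom C f) (Cod C h)"
  obtains u where "u \<in> Arr C" "Dom C u = Cod C c" "Cod C u = Cod C h" "u \<cdot> c = h"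
  using cokernel_ex_factor[OF assms] by blast

lemma kernel_monic:
  assumes "is_kernel C k f"
  shows "monic C k"
proof (rule monicI)
  note [simp] = kernel_simps[OF assms]
  show "k \<in> Arr C" by simp
  fix g assume g [simp]: "g \<in> Arr C" "Cod C g = Dom C k" and eq: "k \<cdot> g = Zero C (Dom C g) (Cod C k)"
  have "Zero C (Dom C g) (Dom C f) \<in> Hom C (Dom C g) (Dom C f)"
    "f \<cdot> Zero C (Dom C g) (Dom C f) = Zero C (Dom C g) (Cod C f)"
    by (simp_all add: in_Hom)
  then have "\<exists>!u. u \<in> Hom C (Dom C g) (Dom C k) \<and> k \<cdot> u = Zero C (Dom C g) (Dom C f)"
    using assms unfolding is_kernel_def by blast
  moreover have "g \<in> Hom C (Dom C g) (Dom C k) \<and> k \<cdot> g = Zero C (Dom C g) (Dom C f)"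
    using eq by (simp add: in_Hom)
  moreover have "Zero C (Dom C g) (Dom C k) \<in> Hom C (Dom C g) (Dom C k) \<and>
      k \<cdot> Zero C (Dom C g) (Dom C k) = Zero C (Dom C g) (Dom C f)"
    by (simp add: in_Hom)
  ultimately show "g = Zero C (Dom C g) (Dom C k)" by blast
qed

lemma cokernel_epic:
  assumes "is_cokernel C c f"
  shows "epic C c"
proof (rule epicI)
  note [simp] = cokernel_simps[OF assms]
  show "c \<in> Arr C" by simp
  fix g assume g [simp]: "g \<in> Arr C" "Dom C g = Cod C c" and eq: "g \<cdot> c = Zero C (Dom C c) (Cod C g)"
  have "Zero C (Cod C f) (Cod C g) \<in> Hom C (Cod C f) (Cod C g)"
    "Zero C (Cod C f) (Cod C g) \<cdot> f = Zero C (Dom C f) (Cod C g)"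
    by (simp_all add: in_Hom)
  then have "\<exists>!u. u \<in> Hom C (Cod C c) (Cod C g) \<and> u \<cdot> c = Zero C (Cod C f) (Cod C g)"
    using assms unfolding is_cokernel_def by blast
  moreover have "g \<in> Hom C (Cod C c) (Cod C g) \<and> g \<cdot> c = Zero C (Cod C f) (Cod C g)"
    using eq by (simp add: in_Hom)
  moreover have "Zero C (Cod C c) (Cod C g) \<in> Hom C (Cod C c) (Cod C g) \<and>
      Zero C (Cod C c) (Cod C g) \<cdot> c = Zero C (Cod C f) (Cod C g)"
    by (simp add: in_Hom)
  ultimately show "g = Zero C (Cod C c) (Cod C g)" by blast
qed

lemma is_kernelI:
  assumes "monic C k" "f \<in> Arr C" "Cod C k = Dom C f" "f \<cdot> k = Zero C (Dom C k) (Cod C f)"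
    and "\<And>h. \<lbrakk>h \<in> Arr C; Cod C h = Dom C f; f \<cdot> h = Zero C (Dom C h) (Cod C f)\<rbrakk>
           \<Longrightarrow> \<exists>u. u \<in> Arr C \<and> Dom C u = Dom C h \<and> Cod C u = Dom C k \<and> k \<cdot> u = h"
  shows "is_kernel C k f"
  unfolding is_kernel_def
proof (intro conjI allI ballI impI)
  fix W h assume h: "h \<in> Hom C W (Dom C f)" "f \<cdot> h = Zero C W (Cod C f)"
  then obtain u where "u \<in> Hom C W (Dom C k)" "k \<cdot> u = h"
    using assms(5)[of h] by (auto simp: in_Hom)
  then show "\<exists>!u. u \<in> Hom C W (Dom C k) \<and> k \<cdot> u = h"
    by (intro ex1I[of _ u]) (use monic_cancel[OF assms(1)] in \<open>simp, auto simp: in_Hom\<close>)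
qed (use assms(1-4) monic_Arr in blast)+

lemma is_cokernelI:
  assumes "epic C c" "f \<in> Arr C" "Dom C c = Cod C f" "c \<cdot> f = Zero C (Dom C f) (Cod C c)"
    and "\<And>h. \<lbrakk>h \<in> Arr C; Dom C h = Cod C f; h \<cdot> f = Zero C (Dom C f) (Cod C h)\<rbrakk>
           \<Longrightarrow> \<exists>u. u \<in> Arr C \<and> Dom C u = Cod C c \<and> Cod C u = Cod C h \<and> u \<cdot> c = h"
  shows "is_cokernel C c f"
  unfolding is_cokernel_def
proof (intro conjI allI ballI impI)
  fix W h assume h: "h \<in> Hom C (Cod C f) W" "h \<cdot> f = Zero C (Dom C f) W"
  then obtain u where "u \<in> Hom C (Cod C c) W" "u \<cdot> c = h"
    using assms(5)[of h] by (auto simp: in_Hom)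
  then show "\<exists>!u. u \<in> Hom C (Cod C c) W \<and> u \<cdot> c = h"
    by (intro ex1I[of _ u]) (use epic_cancel[OF assms(1)] in \<open>simp, auto simp: in_Hom\<close>)
qed (use assms(1-4) epic_Arr in blast)+

text \<open>A mono placed after \<open>p\<close> annihilates nothing new. When short exact sequences
  are spliced, the inclusion \<open>k\<close> thereby becomes a kernel of the spliced
  differential.\<close>

lemma kernel_comp_monic:
  assumes "is_kernel C k p" "monic C m" "Dom C m = Cod C p"
  shows "is_kernel C k (m \<cdot> p)"
proof (rule is_kernelI)
  note [simp] = kernel_simps[OF assms(1)] assms(3) monic_Arr[OF assms(2)]
  show "monic C k" by (rule kernel_monic[OF assms(1)])
  show "m \<cdot> p \<in> Arr C" "Cod C k = Dom C (m \<cdot> p)" by simp_all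
  show "(m \<cdot> p) \<cdot> k = Zero C (Dom C k) (Cod C (m \<cdot> p))" by (simp add: assoc)
  fix h assume h [simp]: "h \<in> Arr C" and "Cod C h = Dom C (m \<cdot> p)"
    and eq: "(m \<cdot> p) \<cdot> h = Zero C (Dom C h) (Cod C (m \<cdot> p))"
  then have [simp]: "Cod C h = Dom C p" by simp
  have "p \<cdot> h = Zero C (Dom C h) (Dom C m)"
    by (rule monic_Zero[OF assms(2)]) (use eq in \<open>simp_all add: assoc\<close>)
  then show "\<exists>u. u \<in> Arr C \<and> Dom C u = Dom C h \<and> Cod C u = Dom C k \<and> k \<cdot> u = h"
    by (intro kernel_ex_factor[OF assms(1), of h]) simp_all
qed

text \<open>The converse, for cutting complexes: with \<open>m \<cdot> p\<close> an epi-mono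
  factorization of a differential, a kernel of the differential is a kernel of its epic
  part.\<close>

lemma kernel_of_comp_monic:
  assumes "is_kernel C k (m \<cdot> p)" "monic C m" "p \<in> Arr C" "Dom C m = Cod C p"
  shows "is_kernel C k p"
proof (rule is_kernelI)
  note [simp] = kernel_simps(1)[OF assms(1)] assms(3,4) monic_Arr[OF assms(2)]
  have [simp]: "Cod C k = Dom C p" using kernel_simps(3)[OF assms(1)] by simp
  show "monic C k" by (rule kernel_monic[OF assms(1)])
  show "p \<in> Arr C" "Cod C k = Dom C p" by simp_all
  have "p \<cdot> k = Zero C (Dom C k) (Dom C m)"
    by (rule monic_Zero[OF assms(2)]) (use kernel_simps(4)[OF assms(1)] in \<open>simp_all add: assoc\<close>)
  then show "p \<cdot> k = Zero C (Dom C k) (Cod C p)" by simp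
  fix h assume h [simp]: "h \<in> Arr C" "Cod C h = Dom C p"
    and eq: "p \<cdot> h = Zero C (Dom C h) (Cod C p)"
  then show "\<exists>u. u \<in> Arr C \<and> Dom C u = Dom C h \<and> Cod C u = Dom C k \<and> k \<cdot> u = h"
    using kernel_ex_factor[OF assms(1), of h] by (simp add: assoc)
qed

end

section \<open>Images and exactness in an abelian category\<close>

context abelian_category
begin

text \<open>Normality only provides some \<open>g\<close> with kernel \<open>m\<close>. Since
  \<open>g\<close> annihilates \<open>m\<close>, it factors through \<open>c\<close>, so whatever
  \<open>c\<close> annihilates is annihilated by \<open>g\<close> and factors through
  \<open>m\<close>.\<close>

lemma monic_kernel:
  assumes "monic C m" "is_cokernel C c m"
  shows "is_kernel C m c"
proof (rule is_kernelI)
  note [simp] = cokernel_simps[OF assms(2)]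
  obtain g where g: "is_kernel C m g" using monic_normal[OF assms(1)] by blast
  note [simp] = kernel_simps[OF g]
  obtain u where u [simp]: "u \<in> Arr C" "Dom C u = Cod C c" "Cod C u = Cod C g" "u \<cdot> c = g"
    by (rule cokernel_factor[OF assms(2), of g]) simp_all
  fix h assume [simp]: "h \<in> Arr C" "Cod C h = Dom C c" and eq: "c \<cdot> h = Zero C (Dom C h) (Cod C c)"
  have "g \<cdot> h = u \<cdot> (c \<cdot> h)" unfolding u(4)[symmetric] by (rule assoc) simp_all
  then have "g \<cdot> h = Zero C (Dom C h) (Cod C g)" by (simp add: eq)
  then show "\<exists>u. u \<in> Arr C \<and> Dom C u = Dom C h \<and> Cod C u = Dom C m \<and> m \<cdot> u = h"
    by (intro kernel_ex_factor[OF g, of h]) simp_all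
qed (use assms cokernel_simps[OF assms(2)] in auto)

text \<open>Dual to \<open>monic_kernel\<close>; it turns an epi with a chosen kernel into a short
  exact sequence.\<close>

lemma epic_cokernel:
  assumes "epic C e" "is_kernel C k e"
  shows "is_cokernel C e k"
proof (rule is_cokernelI)
  note [simp] = kernel_simps[OF assms(2)]
  obtain g where g: "is_cokernel C e g" using epic_normal[OF assms(1)] by blast
  note [simp] = cokernel_simps[OF g]
  obtain u where u [simp]: "u \<in> Arr C" "Cod C u = Dom C k" "Dom C u = Dom C g" "k \<cdot> u = g"
    by (rule kernel_factor[OF assms(2), of g]) simp_all
  fix h assume [simp]: "h \<in> Arr C" "Dom C h = Cod C k" and eq: "h \<cdot> k = Zero C (Dom C k) (Cod C h)"
  have "h \<cdot> g = (h \<cdot> k) \<cdot> u" unfolding u(4)[symmetric] by (rule assoc[symmetric]) simp_all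
  then have "h \<cdot> g = Zero C (Dom C g) (Cod C h)" by (simp add: eq)
  then show "\<exists>u. u \<in> Arr C \<and> Dom C u = Cod C e \<and> Cod C u = Cod C h \<and> u \<cdot> e = h"
    by (intro cokernel_ex_factor[OF g, of h]) simp_all
qed (use assms kernel_simps[OF assms(2)] in auto)

text \<open>Epi-mono factorization. The arrow \<open>e\<close> exists because the cokernel
  \<open>c\<close> annihilates \<open>f\<close>; the substance is that \<open>e\<close> is epic. If
  \<open>g\<close> annihilates \<open>e\<close>, then \<open>f\<close> factors through
  \<open>m \<cdot> k\<close> with \<open>k\<close> a kernel of \<open>g\<close>, and normality of
  this smaller mono forces \<open>k\<close> to be split, so that \<open>g\<close> is zero.\<close>

lemma is_image_factor:
  assumes "is_image C m f"
  obtains e where "epic C e" "Dom C e = Dom C f" "Cod C e = Dom C m" "m \<cdot> e = f" "monic C m"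
    "f \<in> Arr C"
proof -
  obtain c where c: "is_cokernel C c f" "is_kernel C m c"
    using assms unfolding is_image_def by blast
  note [simp] = cokernel_simps[OF c(1)] kernel_simps(1)[OF c(2)]
  have [simp]: "Cod C m = Cod C f" using kernel_simps[OF c(2)] by simp
  have m: "monic C m" by (rule kernel_monic[OF c(2)])
  obtain e where e [simp]: "e \<in> Arr C" "Dom C e = Dom C f" "Cod C e = Dom C m" "m \<cdot> e = f"
    by (rule kernel_factor[OF c(2), of f]) simp_all
  have "epic C e"
  proof (rule epicI)
    fix g assume [simp]: "g \<in> Arr C" and "Dom C g = Cod C e"
      and ge: "g \<cdot> e = Zero C (Dom C e) (Cod C g)"
    then have [simp]: "Dom C g = Dom C m" by simp
    obtain k where k: "is_kernel C k g" using ex_kernel[of g] by auto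
    note [simp] = kernel_simps(1,3)[OF k]
    have kmono: "monic C k" by (rule kernel_monic[OF k])
    obtain e1 where e1 [simp]: "e1 \<in> Arr C" "Dom C e1 = Dom C f" "Cod C e1 = Dom C k" "k \<cdot> e1 = e"
      by (rule kernel_factor[OF k, of e]) (simp_all add: ge)
    have "monic C (m \<cdot> k)"
    proof (rule monicI)
      fix x assume [simp]: "x \<in> Arr C" and "Cod C x = Dom C (m \<cdot> k)"
        and eq: "(m \<cdot> k) \<cdot> x = Zero C (Dom C x) (Cod C (m \<cdot> k))"
      then have [simp]: "Cod C x = Dom C k" by simp
      have "k \<cdot> x = Zero C (Dom C x) (Dom C m)"
        by (rule monic_Zero[OF m]) (use eq in \<open>simp_all add: assoc\<close>)
      then show "x = Zero C (Dom C x) (Dom C (m \<cdot> k))"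
        using monic_Zero[OF kmono, of x] by simp
    qed simp
    \<comment> \<open>The arrow \<open>h\<close> annihilates \<open>f\<close>, hence factors through
      \<open>c\<close> and annihilates \<open>m\<close>. So \<open>m\<close> factors through
      \<open>m \<cdot> k\<close>, and the factor \<open>y\<close> is a right inverse of
      \<open>k\<close>.\<close>
    then obtain h where h: "is_kernel C (m \<cdot> k) h" using monic_normal by blast
    have [simp]: "h \<in> Arr C" "Dom C h = Cod C f" using kernel_simps[OF h] by simp_all
    have hmk: "h \<cdot> (m \<cdot> k) = Zero C (Dom C k) (Cod C h)" using kernel_simps(4)[OF h] by simp
    have "f = (m \<cdot> k) \<cdot> e1" by (simp add: assoc)
    then have "h \<cdot> f = (h \<cdot> (m \<cdot> k)) \<cdot> e1" by (simp add: assoc)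
    then have hf: "h \<cdot> f = Zero C (Dom C f) (Cod C h)" by (simp add: hmk)
    obtain h' where h' [simp]: "h' \<in> Arr C" "Dom C h' = Cod C c" "Cod C h' = Cod C h" "h' \<cdot> c = h"
      by (rule cokernel_factor[OF c(1), of h]) (simp_all add: hf)
    have "h \<cdot> m = h' \<cdot> (c \<cdot> m)" unfolding h'(4)[symmetric] by (rule assoc) simp_all
    then have hm: "h \<cdot> m = Zero C (Dom C m) (Cod C h)" by (simp add: kernel_simps(4)[OF c(2)])
    obtain y where y: "y \<in> Arr C" "Dom C y = Dom C m" "Cod C y = Dom C k" "(m \<cdot> k) \<cdot> y = m"
      by (rule kernel_factor[OF h, of m]) (simp_all add: hm)
    note [simp] = y(1-3)
    have "k \<cdot> y = Ident C (Dom C m)"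
      by (rule monic_cancel[OF m]) (use y(4) in \<open>simp_all add: assoc\<close>)
    then have "g = g \<cdot> (k \<cdot> y)" by simp
    also have "\<dots> = (g \<cdot> k) \<cdot> y" by (simp add: assoc)
    also have "\<dots> = Zero C (Dom C m) (Cod C g)" by (simp add: kernel_simps(4)[OF k])
    finally show "g = Zero C (Cod C e) (Cod C g)" by simp
  qed simp
  then show ?thesis using that m by simp
qed

text \<open>An epic factor does not change which arrows annihilate \<open>m\<close>, so
  \<open>m \<cdot> e\<close> and \<open>m\<close> share the cokernel \<open>c\<close>, whose kernel
  is \<open>m\<close> by normality.\<close>

lemma is_imageI:
  assumes "monic C m" "epic C e" "Cod C e = Dom C m"
  shows "is_image C m (m \<cdot> e)"
proof -
  note [simp] = monic_Arr[OF assms(1)] epic_Arr[OF assms(2)] assms(3)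
  obtain c where c: "is_cokernel C c m" using ex_cokernel[of m] by auto
  note [simp] = cokernel_simps[OF c]
  have "is_cokernel C c (m \<cdot> e)"
  proof (rule is_cokernelI)
    show "epic C c" by (rule cokernel_epic[OF c])
    show "c \<cdot> (m \<cdot> e) = Zero C (Dom C (m \<cdot> e)) (Cod C c)" by (simp add: assoc[symmetric])
    fix h assume [simp]: "h \<in> Arr C" and "Dom C h = Cod C (m \<cdot> e)"
      and eq: "h \<cdot> (m \<cdot> e) = Zero C (Dom C (m \<cdot> e)) (Cod C h)"
    then have [simp]: "Dom C h = Cod C m" by simp
    have "h \<cdot> m = Zero C (Cod C e) (Cod C h)"
      by (rule epic_Zero[OF assms(2)]) (use eq in \<open>simp_all add: assoc\<close>)
    then have "h \<cdot> m = Zero C (Dom C m) (Cod C h)" by simp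
    then show "\<exists>u. u \<in> Arr C \<and> Dom C u = Cod C c \<and> Cod C u = Cod C h \<and> u \<cdot> c = h"
      by (intro cokernel_ex_factor[OF c, of h]) simp_all
  qed simp_all
  then show ?thesis unfolding is_image_def using monic_kernel[OF assms(1) c] by blast
qed

lemma image_ex:
  assumes "f \<in> Arr C"
  shows "\<exists>m. is_image C m f"
proof -
  obtain c where c: "is_cokernel C c f" using ex_cokernel[OF assms] by auto
  then obtain m where "is_kernel C m c" using ex_kernel cokernel_simps(1)[OF c] by blast
  then show ?thesis using c unfolding is_image_def by blast
qed

text \<open>The cokernel with kernel \<open>m'\<close> annihilates \<open>m \<cdot> e = f\<close>,
  hence annihilates \<open>m\<close> because \<open>e\<close> is epic. Used in both directions this
  makes images unique as subobjects.\<close>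

lemma is_image_le:
  assumes "is_image C m f" "is_image C m' f"
  obtains u where "u \<in> Arr C" "Dom C u = Dom C m" "Cod C u = Dom C m'" "m' \<cdot> u = m"
proof -
  obtain e where e: "epic C e" "Dom C e = Dom C f" "Cod C e = Dom C m" "m \<cdot> e = f" "monic C m"
    by (rule is_image_factor[OF assms(1)])
  note [simp] = epic_Arr[OF e(1)] monic_Arr[OF e(5)] e(2,3)
  have [simp]: "f \<in> Arr C" "Cod C f = Cod C m" using e(4) by auto
  obtain c where c: "is_cokernel C c f" "is_kernel C m' c"
    using assms unfolding is_image_def by blast
  note [simp] = cokernel_simps[OF c(1)] kernel_simps(1,3)[OF c(2)]
  have "c \<cdot> m = Zero C (Cod C e) (Cod C c)"
    by (rule epic_Zero[OF e(1)]) (use cokernel_simps(4)[OF c(1)] in \<open>simp_all add: assoc e(4)\<close>)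
  then have cm: "c \<cdot> m = Zero C (Dom C m) (Cod C c)" by simp
  show ?thesis by (rule kernel_factor[OF c(2), of m]) (simp_all add: cm that)
qed

text \<open>The definition of \<open>exact\<close> asks for one arrow that is both image and kernel;
  as images agree up to isomorphism, any given image can be tested.\<close>

lemma exact_factor:
  assumes "is_image C m f"
  shows "exact C f g \<longleftrightarrow> is_kernel C m g"
proof
  assume "exact C f g"
  then obtain m' where m': "is_image C m' f" "is_kernel C m' g" unfolding exact_def by blast
  obtain u where u: "u \<in> Arr C" "Dom C u = Dom C m" "Cod C u = Dom C m'" "m' \<cdot> u = m"
    by (rule is_image_le[OF assms m'(1)])
  obtain v where v: "v \<in> Arr C" "Dom C v = Dom C m'" "Cod C v = Dom C m" "m \<cdot> v = m'"
    by (rule is_image_le[OF m'(1) assms])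
  note [simp] = u(1-3) v(1-3) kernel_simps[OF m'(2)]
  have mon: "monic C m" using is_image_factor[OF assms] by blast
  note [simp] = monic_Arr[OF mon]
  have codm: "Cod C m = Cod C m'" using u(4)[symmetric] by simp
  show "is_kernel C m g"
  proof (rule is_kernelI)
    have "g \<cdot> m = (g \<cdot> m') \<cdot> u" unfolding u(4)[symmetric] by (rule assoc[symmetric]) simp_all
    then show "g \<cdot> m = Zero C (Dom C m) (Cod C g)" by simp
    fix h assume [simp]: "h \<in> Arr C" "Cod C h = Dom C g" and "g \<cdot> h = Zero C (Dom C h) (Cod C g)"
    then obtain x where x: "x \<in> Arr C" "Dom C x = Dom C h" "Cod C x = Dom C m'" "m' \<cdot> x = h"
      using kernel_ex_factor[OF m'(2), of h] by auto
    then have "m \<cdot> (v \<cdot> x) = h" using v(4) codm by (simp add: assoc[symmetric])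
    then show "\<exists>u. u \<in> Arr C \<and> Dom C u = Dom C h \<and> Cod C u = Dom C m \<and> m \<cdot> u = h"
      using x by (intro exI[of _ "v \<cdot> x"]) simp
  qed (simp_all add: mon codm)
next
  assume "is_kernel C m g"
  then show "exact C f g" using assms unfolding exact_def by blast
qed

text \<open>Two kernels of \<open>g\<close> differ by an isomorphism, so the epic part of
  \<open>f\<close> can be moved to a prescribed kernel. This is how long exact sequences are cut
  into short ones.\<close>

lemma exact_kernel:
  assumes "exact C f g" "is_kernel C m g"
  obtains e where "epic C e" "Dom C e = Dom C f" "Cod C e = Dom C m" "m \<cdot> e = f" "f \<in> Arr C"
proof -
  obtain m' where m': "is_image C m' f" "is_kernel C m' g" using assms unfolding exact_def by blast
  obtain e where e: "epic C e" "Dom C e = Dom C f" "Cod C e = Dom C m'" "m' \<cdot> e = f" "f \<in> Arr C"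
    by (rule is_image_factor[OF m'(1)])
  note [simp] = kernel_simps[OF assms(2)] kernel_simps[OF m'(2)] epic_Arr[OF e(1)] e(2,3)
  obtain u where u: "u \<in> Arr C" "Dom C u = Dom C m" "Cod C u = Dom C m'" "m' \<cdot> u = m"
    by (rule kernel_factor[OF m'(2), of m]) simp_all
  obtain v where v: "v \<in> Arr C" "Dom C v = Dom C m'" "Cod C v = Dom C m" "m \<cdot> v = m'"
    by (rule kernel_factor[OF assms(2), of m']) simp_all
  note [simp] = u(1-3) v(1-3)
  have "v \<cdot> u = Ident C (Dom C m)"
    by (rule monic_cancel[OF kernel_monic[OF assms(2)]]) (simp_all add: assoc[symmetric] v(4) u(4))
  then have "epic C v" by (intro split_epic[of v "Dom C m'" "Dom C m" u]) (simp_all add: in_Hom)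
  then have "epic C (v \<cdot> e)" using e by (intro epic_comp) simp_all
  moreover have "m \<cdot> (v \<cdot> e) = f" by (simp add: assoc[symmetric] v(4) e(4))
  ultimately show ?thesis using e(5) by (intro that[of "v \<cdot> e"]) simp_all
qed

text \<open>The identity of \<open>X\<close> is a kernel of the zero arrow, so exactness says that
  the image of \<open>e\<close> is all of \<open>X\<close>.\<close>

lemma exact_to_zero_iff:
  assumes "zero_object C Z" "e \<in> Hom C P X"
  shows "exact C e (Zero C X Z) \<longleftrightarrow> epic C e"
proof -
  have [simp]: "e \<in> Arr C" "Dom C e = P" "Cod C e = X" "X \<in> Ob C" "Z \<in> Ob C"
    using assms Cod_Ob[of e] by (auto simp: in_Hom zero_object_def)
  have "monic C (Ident C X)" by (rule monicI) simp_all
  then have k: "is_kernel C (Ident C X) (Zero C X Z)"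
    by (rule is_kernelI) (simp, simp, simp, simp, metis comp_Ident(1) Zero_simps(2) Ident_simps(2) \<open>X \<in> Ob C\<close> \<open>Z \<in> Ob C\<close>)
  show ?thesis
  proof
    assume "exact C e (Zero C X Z)"
    then obtain e' where "epic C e'" "Cod C e' = X" "Ident C X \<cdot> e' = e"
      using exact_kernel[OF _ k] by (metis Ident_simps(2) \<open>X \<in> Ob C\<close>)
    then show "epic C e" using epic_Arr[of e'] by simp
  next
    assume "epic C e"
    then have "is_image C (Ident C X) e"
      using is_imageI[OF \<open>monic C (Ident C X)\<close>, of e] by simp
    then show "exact C e (Zero C X Z)" using k unfolding exact_def by blast
  qed
qed

text \<open>A kernel of \<open>f\<close> that receives an epi from a zero object is a zero arrow.
  Conversely the zero arrow from \<open>Z\<close> is monic, hence its own image, and it is a kernel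
  of every mono.\<close>

lemma exact_from_zero_iff:
  assumes "zero_object C Z" "f \<in> Hom C M P"
  shows "exact C (Zero C Z M) f \<longleftrightarrow> monic C f"
proof -
  have [simp]: "f \<in> Arr C" "Dom C f = M" "Cod C f = P" "M \<in> Ob C" "Z \<in> Ob C"
    using assms Dom_Ob[of f] by (auto simp: in_Hom zero_object_def)
  show ?thesis
  proof
    assume "exact C (Zero C Z M) f"
    obtain k where k: "is_kernel C k f" using ex_kernel[of f] by auto
    obtain e where e: "epic C e" "Dom C e = Z" "Cod C e = Dom C k" "k \<cdot> e = Zero C Z M"
      using exact_kernel[OF \<open>exact C (Zero C Z M) f\<close> k] by auto
    note [simp] = kernel_simps[OF k] epic_Arr[OF e(1)] e(2,3)
    have "k = Zero C (Cod C e) M" by (rule epic_Zero[OF e(1)]) (use e(4) in simp_all)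
    then have k0: "k = Zero C (Dom C k) M" by simp
    show "monic C f"
    proof (rule monicI)
      fix g assume g: "g \<in> Arr C" "Cod C g = Dom C f" "f \<cdot> g = Zero C (Dom C g) (Cod C f)"
      obtain u where "u \<in> Arr C" "Dom C u = Dom C g" "Cod C u = Dom C k" "k \<cdot> u = g"
        by (rule kernel_factor[OF k g])
      moreover from this have "g = Zero C (Dom C k) M \<cdot> u" using k0 by metis
      ultimately show "g = Zero C (Dom C g) (Dom C f)" by simp
    qed simp
  next
    assume f: "monic C f"
    have zero: "g = Zero C (Dom C g) Z" if "g \<in> Arr C" "Cod C g = Z" for g
    proof -
      have "\<exists>!h. h \<in> Hom C (Dom C g) Z" using assms(1) that by (auto simp: zero_object_def)
      moreover have "g \<in> Hom C (Dom C g) Z" "Zero C (Dom C g) Z \<in> Hom C (Dom C g) Z"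
        using that by (auto simp: in_Hom)
      ultimately show ?thesis by blast
    qed
    have z: "monic C (Zero C Z M)" 
    proof (rule monicI)
      fix g assume "g \<in> Arr C" "Cod C g = Dom C (Zero C Z M)"
      then show "g = Zero C (Dom C g) (Dom C (Zero C Z M))" using zero[of g] by auto
    qed simp
    have "is_image C (Zero C Z M) (Zero C Z M \<cdot> Ident C Z)"
      by (rule is_imageI[OF z Ident_epic]) simp_all
    moreover have "is_kernel C (Zero C Z M) f"
    proof (rule is_kernelI[OF z])
      fix h assume h: "h \<in> Arr C" "Cod C h = Dom C f" "f \<cdot> h = Zero C (Dom C h) (Cod C f)"
      have "h = Zero C (Dom C h) (Dom C f)" by (rule monic_Zero[OF f h(3)]) (use h in simp_all)
      moreover have "Zero C Z M \<cdot> Zero C (Dom C h) Z = Zero C (Dom C h) (Dom C f)"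
        using h by simp
      ultimately have "Zero C Z M \<cdot> Zero C (Dom C h) Z = h" by metis
      then show "\<exists>u. u \<in> Arr C \<and> Dom C u = Dom C h \<and> Cod C u = Dom C (Zero C Z M) \<and> Zero C Z M \<cdot> u = h"
        using h by (intro exI[of _ "Zero C (Dom C h) Z"]) simp
    qed simp_all
    ultimately show "exact C (Zero C Z M) f" unfolding exact_def by auto
  qed
qed

end

section \<open>Short exact sequences with projective middle term\<close>

text \<open>The projective middle object stays implicit as \<open>Cod C k\<close>, which equals
  \<open>Dom C p\<close>.\<close>

definition proj_sequence :: "('o, 'm) addcat \<Rightarrow> 'm \<Rightarrow> 'm \<Rightarrow> 'o \<Rightarrow> 'o \<Rightarrow> bool" where
  "proj_sequence C k p K X \<longleftrightarrow> is_kernel C k p \<and> is_cokernel C p k \<and>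
     projective C (Cod C k) \<and> Dom C k = K \<and> Cod C p = X"

definition approximation_sequence :: "('o, 'm) addcat \<Rightarrow> 'm \<Rightarrow> 'm \<Rightarrow> 'o \<Rightarrow> 'o \<Rightarrow> bool" where
  "approximation_sequence C k p K X \<longleftrightarrow>
     proj_sequence C k p K X \<and> left_projective_approximation C k"

text \<open>Forgetting the arrows leaves a binary relation on objects, so that chains of
  \<open>n\<close> steps are relational powers.\<close>

definition approximation_step :: "('o, 'm) addcat \<Rightarrow> 'o \<Rightarrow> 'o \<Rightarrow> bool" where
  "approximation_step C K X \<longleftrightarrow> (\<exists>k p. approximation_sequence C k p K X)"

text \<open>Equivalently, \<open>X\<close> is a direct summand of \<open>Y \<oplus> F\<close> for some projective \<open>F\<close>.\<close>

definition stable_retract :: "('o, 'm) addcat \<Rightarrow> 'o \<Rightarrow> 'o \<Rightarrow> bool" where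
  "stable_retract C X Y \<longleftrightarrow>
     (\<exists>F. projective C F \<and> (\<exists>t \<in> Hom C X Y. \<exists>w \<in> Hom C Y X. \<exists>s \<in> Hom C X F. \<exists>q \<in> Hom C F X.
        Add C (w \<cdot>\<^bsub>C\<^esub> t) (q \<cdot>\<^bsub>C\<^esub> s) = Ident C X))"

lemma stable_retractE:
  assumes "stable_retract C X Y"
  obtains F t w s q where "projective C F"
    "t \<in> Arr C" "Dom C t = X" "Cod C t = Y" "w \<in> Arr C" "Dom C w = Y" "Cod C w = X"
    "s \<in> Arr C" "Dom C s = X" "Cod C s = F" "q \<in> Arr C" "Dom C q = F" "Cod C q = X"
    "Add C (w \<cdot>\<^bsub>C\<^esub> t) (q \<cdot>\<^bsub>C\<^esub> s) = Ident C X"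
  using assms by (auto simp: stable_retract_def Bex_def in_Hom)

lemma stable_retractI:
  assumes "projective C F" "t \<in> Hom C X Y" "w \<in> Hom C Y X" "s \<in> Hom C X F" "q \<in> Hom C F X"
    "Add C (w \<cdot>\<^bsub>C\<^esub> t) (q \<cdot>\<^bsub>C\<^esub> s) = Ident C X"
  shows "stable_retract C X Y"
  using assms unfolding stable_retract_def by blast

section \<open>Passing stable retracts to cokernels and kernels\<close>

context abelian_category
begin

lemma projective_lift:
  assumes "projective C P" "epic C e" "f \<in> Arr C" "Dom C f = P" "Cod C f = Cod C e"
  obtains g where "g \<in> Arr C" "Dom C g = P" "Cod C g = Dom C e" "e \<cdot> g = f"
proof -
  have "f \<in> Hom C P (Cod C e)" using assms by (simp add: in_Hom)
  then obtain g where "g \<in> Hom C P (Dom C e)" "e \<cdot> g = f"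
    using assms(1,2) unfolding projective_def by blast
  then show ?thesis by (auto simp: in_Hom intro: that)
qed

lemma approximation_extend:
  assumes "left_projective_approximation C k" "projective C Q" "g \<in> Arr C" "Dom C g = Dom C k" "Cod C g = Q"
  obtains h where "h \<in> Arr C" "Dom C h = Cod C k" "Cod C h = Q" "h \<cdot> k = g"
proof -
  have "g \<in> Hom C (Dom C k) Q" using assms by (simp add: in_Hom)
  then obtain h where "h \<in> Hom C (Cod C k) Q" "h \<cdot> k = g"
    using assms(1,2) unfolding left_projective_approximation_def by blast
  then show ?thesis by (auto simp: in_Hom intro: that)
qed

lemma proj_sequenceD:
  assumes "proj_sequence C k p K X"
  shows "k \<in> Arr C" "p \<in> Arr C" "Dom C k = K" "Cod C k = Dom C p" "Cod C p = X"
    "p \<cdot> k = Zero C K X" "K \<in> Ob C" "X \<in> Ob C"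
    "is_kernel C k p" "is_cokernel C p k" "monic C k" "epic C p" "projective C (Dom C p)"
proof -
  have k: "is_kernel C k p" and p: "is_cokernel C p k" and "projective C (Cod C k)"
    and [simp]: "Dom C k = K" "Cod C p = X"
    using assms by (auto simp: proj_sequence_def)
  then show "k \<in> Arr C" "p \<in> Arr C" "Dom C k = K" "Cod C k = Dom C p" "Cod C p = X"
    "p \<cdot> k = Zero C K X" "is_kernel C k p" "is_cokernel C p k" "monic C k" "epic C p"
    "projective C (Dom C p)"
    using kernel_simps[OF k] kernel_monic[OF k] cokernel_epic[OF p] by auto
  show "K \<in> Ob C" "X \<in> Ob C"
    using Dom_Ob[OF kernel_simps(1)[OF k]] Cod_Ob[OF kernel_simps(2)[OF k]] by auto
qed

lemma approximation_step_Ob: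
  assumes "approximation_step C K X"
  shows "K \<in> Ob C" "X \<in> Ob C"
  using assms proj_sequenceD(7,8) unfolding approximation_step_def approximation_sequence_def by blast+

text \<open>The projective \<open>F\<close> enters only through zero arrows.\<close>

lemma iso_stable_retract:
  assumes "isomorphic C X Y" "projective C F" "X \<in> Ob C"
  shows "stable_retract C X Y"
proof -
  obtain t w where tw: "t \<in> Hom C X Y" "w \<in> Hom C Y X" "w \<cdot> t = Ident C X"
    using assms unfolding isomorphic_def by blast
  have [simp]: "F \<in> Ob C" "X \<in> Ob C" using assms by (auto simp: projective_def)
  have "Add C (w \<cdot> t) (Zero C F X \<cdot> Zero C X F) = Ident C X"
    using tw by (simp add: Add_Zero)
  moreover have "Zero C X F \<in> Hom C X F" "Zero C F X \<in> Hom C F X" by (simp_all add: in_Hom)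
  ultimately show ?thesis by (intro stable_retractI[OF assms(2) tw(1,2)])
qed

lemma stable_retract_refl:
  assumes "X \<in> Ob C" "projective C F"
  shows "stable_retract C X X"
proof (rule iso_stable_retract[OF _ assms(2,1)])
  show "isomorphic C X X" using assms(1) unfolding isomorphic_def
    by (intro bexI[of _ "Ident C X"]) (simp_all add: in_Hom)
qed

text \<open>The approximation property extends \<open>t\<close>, \<open>w\<close> and
  \<open>s\<close> to the middle terms. The resulting endomorphism \<open>v\<close> of
  \<open>Dom C \<rho>\<close> fixes \<open>u\<close>, so its complement \<open>r\<close> factors
  through the cokernel \<rho>. Hence the identity of \<open>X\<close> is a sum of an arrow through
  \<open>L\<close> and one through the projective \<open>Dom C \<rho>\<close>.\<close>

lemma stable_retract_cokernel:
  assumes u: "approximation_sequence C u \<rho> M X" and j: "approximation_sequence C j \<pi> N L"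
    and "stable_retract C M N"
  shows "stable_retract C X L"
proof -
  obtain F t w s q where F: "projective C F" and
    [simp]: "t \<in> Arr C" "Dom C t = M" "Cod C t = N" "w \<in> Arr C" "Dom C w = N" "Cod C w = M"
    "s \<in> Arr C" "Dom C s = M" "Cod C s = F" "q \<in> Arr C" "Dom C q = F" "Cod C q = M"
    and wt: "Add C (w \<cdot> t) (q \<cdot> s) = Ident C M"
    by (rule stable_retractE[OF assms(3)])
  have u': "proj_sequence C u \<rho> M X" "left_projective_approximation C u"
    and j': "proj_sequence C j \<pi> N L" "left_projective_approximation C j"
    using u j by (auto simp: approximation_sequence_def)
  note U = proj_sequenceD[OF u'(1)] and J = proj_sequenceD[OF j'(1)]
  note [simp] = U(1-8) J(1-8)
  obtain a where [simp]: "a \<in> Arr C" "Dom C a = Dom C \<rho>" "Cod C a = Dom C \<pi>"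
    and au: "a \<cdot> u = j \<cdot> t"
    by (rule approximation_extend[OF u'(2) J(13), of "j \<cdot> t"]) simp_all
  obtain b where [simp]: "b \<in> Arr C" "Dom C b = Dom C \<pi>" "Cod C b = Dom C \<rho>"
    and bj: "b \<cdot> j = u \<cdot> w"
    by (rule approximation_extend[OF j'(2) U(13), of "u \<cdot> w"]) simp_all
  obtain s1 where [simp]: "s1 \<in> Arr C" "Dom C s1 = Dom C \<rho>" "Cod C s1 = F"
    and s1u: "s1 \<cdot> u = s"
    by (rule approximation_extend[OF u'(2) F, of s]) simp_all
  \<comment> \<open>The second summand accounts for the part of the identity of \<open>M\<close>
    that passes through \<open>F\<close>; it vanishes after composition with \<rho>.\<close>
  define v where "v = Add C (b \<cdot> a) (u \<cdot> (q \<cdot> s1))"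
  have [simp]: "v \<in> Arr C" "Dom C v = Dom C \<rho>" "Cod C v = Dom C \<rho>" by (simp_all add: v_def)
  have bau: "b \<cdot> (a \<cdot> u) = u \<cdot> (w \<cdot> t)" unfolding au by (simp add: assoc[symmetric] bj)
  have "v \<cdot> u = Add C (u \<cdot> (w \<cdot> t)) (u \<cdot> (q \<cdot> s))"
    unfolding v_def by (subst distrib_right) (simp_all add: assoc bau s1u)
  also have "\<dots> = u \<cdot> Add C (w \<cdot> t) (q \<cdot> s)" by (rule distrib_left[symmetric]) simp_all
  finally have vu: "v \<cdot> u = u" by (simp add: wt)
  obtain r where [simp]: "r \<in> Arr C" "Dom C r = Dom C \<rho>" "Cod C r = Dom C \<rho>"
    and vr: "Add C v r = Ident C (Dom C \<rho>)"
    by (rule Add_solve[of v "Ident C (Dom C \<rho>)"]) simp_all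
  have "Add C u (r \<cdot> u) = Add C v r \<cdot> u" by (subst distrib_right) (simp_all add: vu)
  also have "\<dots> = Add C u (Zero C M (Dom C \<rho>))" by (simp add: vr Add_Zero)
  finally have ru: "r \<cdot> u = Zero C M (Dom C \<rho>)" by (rule Add_cancel) simp_all
  obtain \<sigma> where [simp]: "\<sigma> \<in> Arr C" "Dom C \<sigma> = X" "Cod C \<sigma> = Dom C \<rho>" and \<sigma>: "\<sigma> \<cdot> \<rho> = r"
    by (rule cokernel_factor[OF U(10), of r]) (simp_all add: ru)
  have "(\<rho> \<cdot> b) \<cdot> j = (\<rho> \<cdot> u) \<cdot> w" by (simp add: assoc bj del: U(6))
  then have "(\<rho> \<cdot> b) \<cdot> j = Zero C N X" by simp
  then obtain w' where [simp]: "w' \<in> Arr C" "Dom C w' = L" "Cod C w' = X" and w': "w' \<cdot> \<pi> = \<rho> \<cdot> b"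
    using cokernel_ex_factor[OF J(10), of "\<rho> \<cdot> b"] by auto
  have "(\<pi> \<cdot> a) \<cdot> u = (\<pi> \<cdot> j) \<cdot> t" by (simp add: assoc au del: J(6))
  then have "(\<pi> \<cdot> a) \<cdot> u = Zero C M L" by simp
  then obtain t' where [simp]: "t' \<in> Arr C" "Dom C t' = X" "Cod C t' = L" and t': "t' \<cdot> \<rho> = \<pi> \<cdot> a"
    using cokernel_ex_factor[OF U(10), of "\<pi> \<cdot> a"] by auto
  have "\<rho> \<cdot> v = Add C (\<rho> \<cdot> (b \<cdot> a)) ((\<rho> \<cdot> u) \<cdot> (q \<cdot> s1))"
    unfolding v_def by (subst distrib_left) (simp_all add: assoc del: U(6))
  also have "\<dots> = \<rho> \<cdot> (b \<cdot> a)" by (simp add: Add_Zero)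
  finally have \<rho>v: "\<rho> \<cdot> v = \<rho> \<cdot> (b \<cdot> a)" .
  have "w' \<cdot> (\<pi> \<cdot> a) = \<rho> \<cdot> (b \<cdot> a)" by (simp add: assoc[symmetric] w')
  then have "(w' \<cdot> t') \<cdot> \<rho> = \<rho> \<cdot> v" by (simp add: assoc t' \<rho>v)
  then have "Add C (w' \<cdot> t') (\<rho> \<cdot> \<sigma>) \<cdot> \<rho> = Add C (\<rho> \<cdot> v) (\<rho> \<cdot> r)"
    by (subst distrib_right) (simp_all add: assoc \<sigma>)
  also have "\<dots> = \<rho> \<cdot> Add C v r" by (rule distrib_left[symmetric]) simp_all
  finally have "Add C (w' \<cdot> t') (\<rho> \<cdot> \<sigma>) \<cdot> \<rho> = Ident C X \<cdot> \<rho>" by (simp add: vr)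
  then have "Add C (w' \<cdot> t') (\<rho> \<cdot> \<sigma>) = Ident C X"
    by (rule epic_cancel[OF U(12)]) simp_all
  \<comment> \<open>The projective summand is now the middle term \<open>Dom C \<rho>\<close>
    instead of the original \<open>F\<close>.\<close>
  then show ?thesis by (intro stable_retractI[OF U(13), of t' _ _ w' \<sigma> \<rho>]) (simp_all add: in_Hom)
qed

text \<open>Dual to \<open>stable_retract_cokernel\<close>, with lifting from projectives in place
  of extension along approximations. The sequence of \<open>X\<close> is an arbitrary
  \<open>proj_sequence\<close>: the approximation property is carried over from \<open>k'\<close> to
  \<open>k\<close>, which makes the lemma apply to any projective resolution.\<close>

lemma stable_retract_kernel:
  assumes kp: "proj_sequence C k p K X" and kp': "approximation_sequence C k' p' K' Y"
    and "stable_retract C X Y"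
  shows "approximation_sequence C k p K X \<and> stable_retract C K K'"
proof -
  obtain F t w s q where F: "projective C F" and
    [simp]: "t \<in> Arr C" "Dom C t = X" "Cod C t = Y" "w \<in> Arr C" "Dom C w = Y" "Cod C w = X"
    "s \<in> Arr C" "Dom C s = X" "Cod C s = F" "q \<in> Arr C" "Dom C q = F" "Cod C q = X"
    and wt: "Add C (w \<cdot> t) (q \<cdot> s) = Ident C X"
    by (rule stable_retractE[OF assms(3)])
  have j': "proj_sequence C k' p' K' Y" "left_projective_approximation C k'"
    using kp' by (auto simp: approximation_sequence_def)
  note U = proj_sequenceD[OF kp] and J = proj_sequenceD[OF j'(1)]
  note [simp] = U(1-8) J(1-8)
  obtain a where [simp]: "a \<in> Arr C" "Dom C a = Dom C p" "Cod C a = Dom C p'" and pa: "p' \<cdot> a = t \<cdot> p"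
    by (rule projective_lift[OF U(13) J(12), of "t \<cdot> p"]) simp_all
  obtain b where [simp]: "b \<in> Arr C" "Dom C b = Dom C p'" "Cod C b = Dom C p" and pb: "p \<cdot> b = w \<cdot> p'"
    by (rule projective_lift[OF J(13) U(12), of "w \<cdot> p'"]) simp_all
  obtain q1 where [simp]: "q1 \<in> Arr C" "Dom C q1 = F" "Cod C q1 = Dom C p" and pq1: "p \<cdot> q1 = q"
    by (rule projective_lift[OF F U(12), of q]) simp_all
  have "p' \<cdot> (a \<cdot> k) = (p' \<cdot> a) \<cdot> k" by (simp add: assoc)
  then have "p' \<cdot> (a \<cdot> k) = Zero C K Y" by (simp add: pa assoc)
  then obtain a' where [simp]: "a' \<in> Arr C" "Dom C a' = K" "Cod C a' = K'" and a': "k' \<cdot> a' = a \<cdot> k"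
    using kernel_ex_factor[OF J(9), of "a \<cdot> k"] by auto
  have "p \<cdot> (b \<cdot> k') = (p \<cdot> b) \<cdot> k'" by (simp add: assoc)
  then have "p \<cdot> (b \<cdot> k') = Zero C K' X" by (simp add: pb assoc)
  then obtain b' where [simp]: "b' \<in> Arr C" "Dom C b' = K'" "Cod C b' = K" and b': "k \<cdot> b' = b \<cdot> k'"
    using kernel_ex_factor[OF U(9), of "b \<cdot> k'"] by auto
  \<comment> \<open>This \<open>c\<close> lifts the identity of \<open>X\<close>, that is
    \<open>p \<cdot> c = p\<close>, so its complement \<open>r\<close> lands in the kernel of
    \<open>p\<close> and comes from some \<sigma>.\<close>
  define c where "c = Add C (b \<cdot> a) (q1 \<cdot> (s \<cdot> p))"
  have [simp]: "c \<in> Arr C" "Dom C c = Dom C p" "Cod C c = Dom C p" by (simp_all add: c_def)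
  have "(p \<cdot> b) \<cdot> a = w \<cdot> (t \<cdot> p)" by (simp add: pb assoc pa)
  then have pba: "p \<cdot> (b \<cdot> a) = (w \<cdot> t) \<cdot> p" by (simp add: assoc)
  have pqs: "p \<cdot> (q1 \<cdot> (s \<cdot> p)) = (q \<cdot> s) \<cdot> p" by (simp add: assoc[symmetric] pq1)
  have "p \<cdot> c = Add C ((w \<cdot> t) \<cdot> p) ((q \<cdot> s) \<cdot> p)"
    unfolding c_def by (subst distrib_left) (simp_all add: pba pqs)
  also have "\<dots> = Add C (w \<cdot> t) (q \<cdot> s) \<cdot> p" by (rule distrib_right[symmetric]) simp_all
  finally have pc: "p \<cdot> c = p" by (simp add: wt)
  obtain r where [simp]: "r \<in> Arr C" "Dom C r = Dom C p" "Cod C r = Dom C p"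
    and cr: "Add C c r = Ident C (Dom C p)"
    by (rule Add_solve[of c "Ident C (Dom C p)"]) simp_all
  have "Add C p (p \<cdot> r) = p \<cdot> Add C c r" by (subst distrib_left) (simp_all add: pc)
  also have "\<dots> = Add C p (Zero C (Dom C p) X)" by (simp add: cr Add_Zero)
  finally have pr: "p \<cdot> r = Zero C (Dom C p) X" by (rule Add_cancel) simp_all
  obtain \<sigma> where [simp]: "\<sigma> \<in> Arr C" "Dom C \<sigma> = Dom C p" "Cod C \<sigma> = K" and \<sigma>: "k \<cdot> \<sigma> = r"
    using kernel_ex_factor[OF U(9), of r] by (auto simp: pr)
  have "k \<cdot> (b' \<cdot> a') = b \<cdot> (k' \<cdot> a')" by (simp add: assoc[symmetric] b')
  then have kba: "k \<cdot> (b' \<cdot> a') = b \<cdot> (a \<cdot> k)" by (simp add: a')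
  have ck: "c \<cdot> k = b \<cdot> (a \<cdot> k)"
    unfolding c_def by (subst distrib_right) (simp_all add: assoc Add_Zero)
  have ks: "k \<cdot> (\<sigma> \<cdot> k) = r \<cdot> k" by (simp add: assoc[symmetric] \<sigma>)
  have "k \<cdot> Add C (b' \<cdot> a') (\<sigma> \<cdot> k) = Add C (c \<cdot> k) (r \<cdot> k)"
    by (subst distrib_left) (simp_all add: kba ck ks)
  also have "\<dots> = Add C c r \<cdot> k" by (rule distrib_right[symmetric]) simp_all
  finally have "k \<cdot> Add C (b' \<cdot> a') (\<sigma> \<cdot> k) = k \<cdot> Ident C K" by (simp add: cr)
  then have one: "Add C (b' \<cdot> a') (\<sigma> \<cdot> k) = Ident C K"
    by (rule monic_cancel[OF U(11)]) simp_all
  then have retr: "stable_retract C K K'"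
    by (intro stable_retractI[OF U(13), of a' _ _ b' k \<sigma>]) (simp_all add: in_Hom)
  \<comment> \<open>By \<open>one\<close>, \<open>g\<close> is the sum of
    \<open>g \<cdot> (b' \<cdot> a')\<close> and \<open>g \<cdot> (\<sigma> \<cdot> k)\<close>. The
    first extends because \<open>g \<cdot> b'\<close> extends along \<open>k'\<close>; the second
    visibly extends to \<open>g \<cdot> \<sigma>\<close>.\<close>
  have "\<exists>h \<in> Hom C (Cod C k) Q. h \<cdot> k = g" if Q: "projective C Q" and g: "g \<in> Hom C (Dom C k) Q" for Q g
  proof -
    have [simp]: "g \<in> Arr C" "Dom C g = K" "Cod C g = Q" using g by (auto simp: in_Hom)
    obtain h where [simp]: "h \<in> Arr C" "Dom C h = Dom C p'" "Cod C h = Q" and h: "h \<cdot> k' = g \<cdot> b'"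
      by (rule approximation_extend[OF j'(2) Q, of "g \<cdot> b'"]) simp_all
    have "h \<cdot> (a \<cdot> k) = (h \<cdot> k') \<cdot> a'" by (simp add: assoc a')
    then have hak: "h \<cdot> (a \<cdot> k) = g \<cdot> (b' \<cdot> a')" by (simp add: h assoc)
    have "Add C (h \<cdot> a) (g \<cdot> \<sigma>) \<cdot> k = Add C (g \<cdot> (b' \<cdot> a')) (g \<cdot> (\<sigma> \<cdot> k))"
      by (subst distrib_right) (simp_all add: assoc hak)
    also have "\<dots> = g \<cdot> Add C (b' \<cdot> a') (\<sigma> \<cdot> k)" by (rule distrib_left[symmetric]) simp_all
    finally have "Add C (h \<cdot> a) (g \<cdot> \<sigma>) \<cdot> k = g" by (simp add: one)
    then show ?thesis by (intro bexI[of _ "Add C (h \<cdot> a) (g \<cdot> \<sigma>)"]) (simp_all add: in_Hom)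
  qed
  then have "left_projective_approximation C k"
    using U(13) unfolding left_projective_approximation_def by simp
  then show ?thesis using kp retr by (simp add: approximation_sequence_def)
qed

section \<open>Constructing approximations for stable retracts, and chains of steps\<close>

lemma biproduct_projective:
  assumes P: "projective C P" "projective C Q"
  obtains S i j p q where "projective C S" "i \<in> Hom C P S" "j \<in> Hom C Q S" "p \<in> Hom C S P" "q \<in> Hom C S Q"
    "p \<cdot> i = Ident C P" "q \<cdot> j = Ident C Q" "p \<cdot> j = Zero C Q P" "q \<cdot> i = Zero C P Q"
proof -
  have [simp]: "P \<in> Ob C" "Q \<in> Ob C" using P by (auto simp: projective_def)
  obtain S i j p q where h: "i \<in> Hom C P S" "j \<in> Hom C Q S" "p \<in> Hom C S P" "q \<in> Hom C S Q"
    and e: "p \<cdot> i = Ident C P" "q \<cdot> j = Ident C Q" "Add C (i \<cdot> p) (j \<cdot> q) = Ident C S"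
    using ex_biproduct[of P Q] by auto
  have [simp]: "i \<in> Arr C" "Dom C i = P" "Cod C i = S" "j \<in> Arr C" "Dom C j = Q" "Cod C j = S"
    "p \<in> Arr C" "Dom C p = S" "Cod C p = P" "q \<in> Arr C" "Dom C q = S" "Cod C q = Q"
    using h by (auto simp: in_Hom)
  have [simp]: "S \<in> Ob C" using Dom_Ob[of p] by simp
  \<comment> \<open>The axiom \<open>ex_biproduct\<close> does not state orthogonality. Composing
    the decomposition of the identity with \<open>p\<close> on the left and with \<open>i\<close> on
    the right, and cancelling, shows that \<open>p \<cdot> j\<close> and \<open>q \<cdot> i\<close>
    are zero.\<close>
  have "p \<cdot> Add C (i \<cdot> p) (j \<cdot> q) = Add C (p \<cdot> (i \<cdot> p)) (p \<cdot> (j \<cdot> q))"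
    by (rule distrib_left) simp_all
  also have "p \<cdot> (i \<cdot> p) = p" by (simp add: assoc[symmetric] e)
  finally have "Add C p (p \<cdot> (j \<cdot> q)) = Add C p (Zero C S P)" by (simp add: e Add_Zero)
  then have "p \<cdot> (j \<cdot> q) = Zero C S P" by (rule Add_cancel) simp_all
  then have "(p \<cdot> (j \<cdot> q)) \<cdot> j = Zero C Q P" by simp
  then have pj: "p \<cdot> j = Zero C Q P" by (simp add: assoc e)
  have "Add C (i \<cdot> p) (j \<cdot> q) \<cdot> i = Add C ((i \<cdot> p) \<cdot> i) ((j \<cdot> q) \<cdot> i)"
    by (rule distrib_right) simp_all
  also have "(i \<cdot> p) \<cdot> i = i" by (simp add: assoc e)
  finally have "Add C i ((j \<cdot> q) \<cdot> i) = Add C i (Zero C P S)" by (simp add: e Add_Zero)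
  then have "(j \<cdot> q) \<cdot> i = Zero C P S" by (rule Add_cancel) simp_all
  then have "q \<cdot> ((j \<cdot> q) \<cdot> i) = Zero C P Q" by simp
  then have "(q \<cdot> j) \<cdot> (q \<cdot> i) = Zero C P Q" by (simp add: assoc)
  then have qi: "q \<cdot> i = Zero C P Q" by (simp add: e)
  have "\<exists>g \<in> Hom C S (Dom C x). x \<cdot> g = f" if x: "epic C x" and f: "f \<in> Hom C S (Cod C x)" for x f
  proof -
    have [simp]: "f \<in> Arr C" "Dom C f = S" "Cod C f = Cod C x" "x \<in> Arr C"
      using f epic_Arr[OF x] by (auto simp: in_Hom)
    obtain g where [simp]: "g \<in> Arr C" "Dom C g = P" "Cod C g = Dom C x" and g: "x \<cdot> g = f \<cdot> i"
      by (rule projective_lift[OF P(1) x, of "f \<cdot> i"]) simp_all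
    obtain h where [simp]: "h \<in> Arr C" "Dom C h = Q" "Cod C h = Dom C x" and h: "x \<cdot> h = f \<cdot> j"
      by (rule projective_lift[OF P(2) x, of "f \<cdot> j"]) simp_all
    have "x \<cdot> Add C (g \<cdot> p) (h \<cdot> q) = Add C ((x \<cdot> g) \<cdot> p) ((x \<cdot> h) \<cdot> q)"
      by (subst distrib_left) (simp_all add: assoc)
    also have "\<dots> = Add C (f \<cdot> (i \<cdot> p)) (f \<cdot> (j \<cdot> q))" by (simp add: g h assoc)
    also have "\<dots> = f \<cdot> Add C (i \<cdot> p) (j \<cdot> q)" by (rule distrib_left[symmetric]) simp_all
    finally have "x \<cdot> Add C (g \<cdot> p) (h \<cdot> q) = f" by (simp add: e)
    then show ?thesis by (intro bexI[of _ "Add C (g \<cdot> p) (h \<cdot> q)"]) (simp_all add: in_Hom)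
  qed
  then have "projective C S" unfolding projective_def by simp
  then show ?thesis using that h e pj qi by blast
qed

lemma approximation_sequence_of_monic:
  assumes "monic C u" "left_projective_approximation C u"
  shows "\<exists>\<rho>. approximation_sequence C u \<rho> (Dom C u) (Cod C \<rho>)"
proof -
  obtain \<rho> where "is_cokernel C \<rho> u" using ex_cokernel monic_Arr[OF assms(1)] by blast
  then show ?thesis using assms monic_kernel[OF assms(1)]
    by (auto simp: approximation_sequence_def proj_sequence_def left_projective_approximation_def)
qed

text \<open>From the approximation \<open>k\<close> of \<open>N\<close> one for \<open>M\<close> is
  built: the components \<open>k \<cdot> t\<close> and \<open>s\<close> map \<open>M\<close> into
  the biproduct of \<open>Dom C \<pi>\<close> and \<open>F\<close>. The identity \<open>wt\<close>
  makes this arrow \<open>u\<close> monic and shows that arrows to projectives extend along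
  it.\<close>

lemma stable_retract_approximation:
  assumes "stable_retract C M N" "approximation_step C N L"
  obtains X where "approximation_step C M X" "stable_retract C X L"
proof -
  obtain F t w s q where F: "projective C F" and
    [simp]: "t \<in> Arr C" "Dom C t = M" "Cod C t = N" "w \<in> Arr C" "Dom C w = N" "Cod C w = M"
    "s \<in> Arr C" "Dom C s = M" "Cod C s = F" "q \<in> Arr C" "Dom C q = F" "Cod C q = M"
    and wt: "Add C (w \<cdot> t) (q \<cdot> s) = Ident C M"
    by (rule stable_retractE[OF assms(1)])
  obtain k \<pi> where k: "approximation_sequence C k \<pi> N L" using assms(2) by (auto simp: approximation_step_def)
  then have k': "proj_sequence C k \<pi> N L" "left_projective_approximation C k"
    by (auto simp: approximation_sequence_def)
  note J = proj_sequenceD[OF k'(1)]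
  note [simp] = J(1-8)
  obtain S i j p p' where S: "projective C S" and H: "i \<in> Hom C (Dom C \<pi>) S" "j \<in> Hom C F S"
    "p \<in> Hom C S (Dom C \<pi>)" "p' \<in> Hom C S F"
    and e: "p \<cdot> i = Ident C (Dom C \<pi>)" "p' \<cdot> j = Ident C F" "p \<cdot> j = Zero C F (Dom C \<pi>)"
      "p' \<cdot> i = Zero C (Dom C \<pi>) F"
    by (rule biproduct_projective[OF J(13) F])
  have [simp]: "i \<in> Arr C" "Dom C i = Dom C \<pi>" "Cod C i = S" "j \<in> Arr C" "Dom C j = F" "Cod C j = S"
    "p \<in> Arr C" "Dom C p = S" "Cod C p = Dom C \<pi>" "p' \<in> Arr C" "Dom C p' = S" "Cod C p' = F"
    using H by (auto simp: in_Hom)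
  have [simp]: "M \<in> Ob C" "F \<in> Ob C" "S \<in> Ob C" using Dom_Ob[of s] Cod_Ob[of s] Dom_Ob[of p] by simp_all
  define u where "u = Add C (i \<cdot> (k \<cdot> t)) (j \<cdot> s)"
  have [simp]: "u \<in> Arr C" "Dom C u = M" "Cod C u = S" by (simp_all add: u_def)
  have "p \<cdot> u = Add C ((p \<cdot> i) \<cdot> (k \<cdot> t)) ((p \<cdot> j) \<cdot> s)"
    unfolding u_def by (subst distrib_left) (simp_all add: assoc)
  then have pu: "p \<cdot> u = k \<cdot> t" by (simp add: e Add_Zero)
  have "p' \<cdot> u = Add C ((p' \<cdot> i) \<cdot> (k \<cdot> t)) ((p' \<cdot> j) \<cdot> s)"
    unfolding u_def by (subst distrib_left) (simp_all add: assoc)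
  then have p'u: "p' \<cdot> u = s" by (simp add: e Add_Zero)
  have "monic C u"
  proof (rule monicI)
    fix x assume [simp]: "x \<in> Arr C" and "Cod C x = Dom C u" and ux: "u \<cdot> x = Zero C (Dom C x) (Cod C u)"
    then have [simp]: "Cod C x = M" by simp
    have "(p \<cdot> u) \<cdot> x = Zero C (Dom C x) (Dom C \<pi>)" by (simp add: assoc ux)
    then have ktx: "k \<cdot> (t \<cdot> x) = Zero C (Dom C x) (Dom C \<pi>)" by (simp add: pu assoc)
    have tx: "t \<cdot> x = Zero C (Dom C x) (Dom C k)"
      by (rule monic_Zero[OF J(11) ktx]) simp_all
    have "(p' \<cdot> u) \<cdot> x = Zero C (Dom C x) F" by (simp add: assoc ux)
    then have sx: "s \<cdot> x = Zero C (Dom C x) F" by (simp add: p'u)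
    have "Add C (w \<cdot> t) (q \<cdot> s) \<cdot> x = Zero C (Dom C x) M"
      by (subst distrib_right) (simp_all add: assoc tx sx Add_Zero)
    then show "x = Zero C (Dom C x) (Dom C u)" by (simp add: wt)
  qed simp
  moreover have "left_projective_approximation C u"
    unfolding left_projective_approximation_def
  proof (intro conjI allI impI ballI)
    fix Q g assume Q: "projective C Q" and "g \<in> Hom C (Dom C u) Q"
    then have [simp]: "g \<in> Arr C" "Dom C g = M" "Cod C g = Q" by (auto simp: in_Hom)
    obtain h where [simp]: "h \<in> Arr C" "Dom C h = Dom C \<pi>" "Cod C h = Q" and h: "h \<cdot> k = g \<cdot> w"
      by (rule approximation_extend[OF k'(2) Q, of "g \<cdot> w"]) simp_all
    have hkt: "h \<cdot> (k \<cdot> t) = g \<cdot> (w \<cdot> t)" by (simp add: assoc[symmetric] h)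
    \<comment> \<open>The summand of \<open>g\<close> passing through \<open>N\<close> is extended
      by \<open>h\<close> on the first component, the one passing through \<open>F\<close> by
      \<open>g \<cdot> q\<close> on the second.\<close>
    have "Add C (h \<cdot> p) (g \<cdot> (q \<cdot> p')) \<cdot> u = Add C (g \<cdot> (w \<cdot> t)) (g \<cdot> (q \<cdot> s))"
      by (subst distrib_right) (simp_all add: assoc pu p'u hkt)
    also have "\<dots> = g \<cdot> Add C (w \<cdot> t) (q \<cdot> s)" by (rule distrib_left[symmetric]) simp_all
    finally have "Add C (h \<cdot> p) (g \<cdot> (q \<cdot> p')) \<cdot> u = g" by (simp add: wt)
    then show "\<exists>h \<in> Hom C (Cod C u) Q. h \<cdot> u = g"
      by (intro bexI[of _ "Add C (h \<cdot> p) (g \<cdot> (q \<cdot> p'))"]) (simp_all add: in_Hom)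
  qed (use S in simp_all)
  ultimately obtain \<rho> where \<rho>: "approximation_sequence C u \<rho> M (Cod C \<rho>)"
    using approximation_sequence_of_monic[of u] by auto
  then show ?thesis using that stable_retract_cokernel[OF \<rho> k assms(1)] 
    unfolding approximation_step_def by blast
qed

text \<open>Transfers the existence of a chain: the steps from \<open>M\<close> are newly
  constructed, with a stable retract kept at every stage.\<close>

lemma relpowp_stable_retract:
  assumes "stable_retract C M N" "(approximation_step C ^^ n) N L"
  obtains X where "(approximation_step C ^^ n) M X" "stable_retract C X L"
  using assms
proof (induction n arbitrary: M N thesis)
  case 0
  then show ?case by auto
next
  case (Suc n)
  obtain N' where N': "approximation_step C N N'" "(approximation_step C ^^ n) N' L"
    using relpowp_Suc_D2[OF Suc.prems(3)] by blast
  obtain M' where M': "approximation_step C M M'" "stable_retract C M' N'"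
    by (rule stable_retract_approximation[OF Suc.prems(2) N'(1)])
  obtain X where "(approximation_step C ^^ n) M' X" "stable_retract C X L"
    using Suc.IH[OF _ M'(2) N'(2)] by blast
  then show ?case using Suc.prems(1) relpowp_Suc_I2[of "approximation_step C", OF M'(1)] by blast
qed

text \<open>Compares two given chains of equal length, so the approximations chosen along them do
  not matter.\<close>

lemma relpowp_stable_retract_cokernel:
  assumes "stable_retract C M N" "(approximation_step C ^^ n) M X" "(approximation_step C ^^ n) N L"
  shows "stable_retract C X L"
  using assms
proof (induction n arbitrary: M N)
  case 0
  then show ?case by auto
next
  case (Suc n)
  obtain M' where M': "approximation_step C M M'" "(approximation_step C ^^ n) M' X"
    using relpowp_Suc_D2[OF Suc.prems(2)] by blast
  obtain N' where N': "approximation_step C N N'" "(approximation_step C ^^ n) N' L"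
    using relpowp_Suc_D2[OF Suc.prems(3)] by blast
  have "stable_retract C M' N'"
    using M'(1) N'(1) stable_retract_cokernel Suc.prems(1) unfolding approximation_step_def by blast
  then show ?case using Suc.IH M'(2) N'(2) by blast
qed

end

section \<open>Torsionfree objects\<close>

context abelian_category
begin

text \<open>As \<open>e\<close> is epic, the same arrows annihilate \<open>f \<cdot> e\<close> and
  \<open>f\<close>; so cokernels, and with them images, coincide.\<close>

lemma is_cokernel_comp_epic:
  assumes "epic C e" "f \<in> Arr C" "Cod C e = Dom C f"
  shows "is_cokernel C c (f \<cdot> e) \<longleftrightarrow> is_cokernel C c f"
proof -
  note [simp] = epic_Arr[OF assms(1)] assms(2,3)
  have eq: "h \<cdot> (f \<cdot> e) = Zero C (Dom C e) W \<longleftrightarrow> h \<cdot> f = Zero C (Dom C f) W"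
    if "h \<in> Arr C" "Dom C h = Cod C f" "Cod C h = W" for h W
  proof
    assume "h \<cdot> (f \<cdot> e) = Zero C (Dom C e) W"
    then have "h \<cdot> f = Zero C (Cod C e) W"
      using that by (intro epic_Zero[OF assms(1)]) (simp_all add: assoc)
    then show "h \<cdot> f = Zero C (Dom C f) W" by simp
  next
    assume "h \<cdot> f = Zero C (Dom C f) W"
    then show "h \<cdot> (f \<cdot> e) = Zero C (Dom C e) W"
      using that Cod_Ob[of h] by (simp add: assoc[symmetric])
  qed
  have "(\<forall>W. \<forall>h \<in> Hom C (Cod C f) W. h \<cdot> (f \<cdot> e) = Zero C (Dom C e) W \<longrightarrow> Q W h) \<longleftrightarrow>
      (\<forall>W. \<forall>h \<in> Hom C (Cod C f) W. h \<cdot> f = Zero C (Dom C f) W \<longrightarrow> Q W h)" for Q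
    using eq by (auto simp: in_Hom)
  then show ?thesis unfolding is_cokernel_def using eq[of c "Cod C c"] by auto
qed

lemma is_image_comp_epic:
  assumes "epic C e" "f \<in> Arr C" "Cod C e = Dom C f"
  shows "is_image C m (f \<cdot> e) \<longleftrightarrow> is_image C m f"
  unfolding is_image_def is_cokernel_comp_epic[OF assms] ..

lemma monic_is_image:
  assumes "monic C m"
  shows "is_image C m m"
  using is_imageI[OF assms Ident_epic[of "Dom C m"]] monic_Arr[OF assms] by simp

text \<open>To extend \<open>g\<close> along \<open>m\<close>, extend \<open>g \<cdot> e\<close>
  along \<open>f\<close> and cancel the epi \<open>e\<close>.\<close>

lemma image_left_projective_approximation:
  assumes "is_image C m f" "left_projective_approximation C f"
  shows "left_projective_approximation C m"
  unfolding left_projective_approximation_def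
proof (intro conjI allI impI ballI)
  obtain e where e: "epic C e" "Dom C e = Dom C f" "Cod C e = Dom C m" "m \<cdot> e = f" "monic C m"
    by (rule is_image_factor[OF assms(1)])
  note [simp] = epic_Arr[OF e(1)] monic_Arr[OF e(5)] e(2,3)
  have cod [simp]: "Cod C f = Cod C m" unfolding e(4)[symmetric] by simp
  show "m \<in> Arr C" by simp
  show "projective C (Cod C m)" using assms(2) by (simp add: left_projective_approximation_def)
  fix Q g assume Q: "projective C Q" and g: "g \<in> Hom C (Dom C m) Q"
  then have [simp]: "g \<in> Arr C" "Dom C g = Dom C m" "Cod C g = Q" by (auto simp: in_Hom)
  obtain h where [simp]: "h \<in> Arr C" "Dom C h = Cod C m" "Cod C h = Q" and h: "h \<cdot> f = g \<cdot> e"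
    by (rule approximation_extend[OF assms(2) Q, of "g \<cdot> e"]) simp_all
  have "h \<cdot> m = g" by (rule epic_cancel[OF e(1)]) (simp_all add: assoc e(4) h)
  then show "\<exists>h \<in> Hom C (Cod C m) Q. h \<cdot> m = g" by (intro bexI[of _ h]) (simp_all add: in_Hom)
qed

text \<open>A mono is one of its own images, so the quantifier over images in
  \<open>torsionfree\<close> collapses for it.\<close>

lemma monic_images_approximation_iff:
  assumes "monic C f"
  shows "(\<forall>m. is_image C m f \<longrightarrow> left_projective_approximation C m) \<longleftrightarrow>
    left_projective_approximation C f"
  using monic_is_image[OF assms] image_left_projective_approximation by blast

text \<open>Projectivity of \<open>P i\<close> for \<open>i \<ge> 1\<close> is omitted, as it follows from the approximation condition.\<close>

definition torsionfree_data :: "nat \<Rightarrow> (nat \<Rightarrow> 'a) \<Rightarrow> (nat \<Rightarrow> 'b) \<Rightarrow> bool" where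
  "torsionfree_data n P f \<longleftrightarrow>
     (\<forall>i \<in> {1..n}. f i \<in> Hom C (P (i - 1)) (P i)) \<and> monic C (f 1) \<and>
     (\<forall>i \<in> {1..<n}. exact C (f i) (f (Suc i))) \<and>
     (\<forall>i \<in> {1..n}. \<forall>m. is_image C m (f i) \<longrightarrow> left_projective_approximation C m)"

lemma torsionfree_iff_data:
  assumes "n \<ge> 1"
  shows "torsionfree C n M \<longleftrightarrow> (\<exists>P f. P 0 = M \<and> torsionfree_data n P f)"
proof
  assume "torsionfree C n M"
  then obtain P f Z where h: "P 0 = M" "\<forall>i \<in> {1..n}. f i \<in> Hom C (P (i - 1)) (P i)"
    "zero_object C Z" "exact C (Zero C Z M) (f 1)" "\<forall>i \<in> {1..<n}. exact C (f i) (f (Suc i))"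
    "\<forall>i \<in> {1..n}. \<forall>m. is_image C m (f i) \<longrightarrow> left_projective_approximation C m"
    unfolding torsionfree_def by blast
  have "f 1 \<in> Hom C M (P 1)" using h(1,2) assms by force
  then have "monic C (f 1)" using exact_from_zero_iff[OF h(3)] h(4) by blast
  then show "\<exists>P f. P 0 = M \<and> torsionfree_data n P f"
    using h unfolding torsionfree_data_def by blast
next
  assume "\<exists>P f. P 0 = M \<and> torsionfree_data n P f"
  then obtain P f where h: "P 0 = M" "\<forall>i \<in> {1..n}. f i \<in> Hom C (P (i - 1)) (P i)"
    "monic C (f 1)" "\<forall>i \<in> {1..<n}. exact C (f i) (f (Suc i))"
    "\<forall>i \<in> {1..n}. \<forall>m. is_image C m (f i) \<longrightarrow> left_projective_approximation C m"
    unfolding torsionfree_data_def by blast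
  have f1: "f 1 \<in> Hom C M (P 1)" using h(1,2) assms by force
  obtain Z where Z: "zero_object C Z" using ex_zero_object by blast
  then have "exact C (Zero C Z M) (f 1)" using exact_from_zero_iff[OF Z f1] h(3) by blast
  moreover have "M \<in> Ob C" using f1 Dom_Ob[of "f 1"] by (auto simp: in_Hom)
  \<comment> \<open>An image of \<open>f i\<close> has codomain \<open>P i\<close>, and its
    approximation property includes projectivity of the codomain.\<close>
  moreover have "\<forall>i \<in> {1..n}. projective C (P i)"
  proof
    fix i assume i: "i \<in> {1..n}"
    then have fi: "f i \<in> Arr C" "Cod C (f i) = P i" using h(2) by (auto simp: in_Hom)
    obtain m where m: "is_image C m (f i)" using image_ex[OF fi(1)] by blast
    then have "projective C (Cod C m)"
      using h(5) i by (auto simp: left_projective_approximation_def)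
    moreover obtain e where "epic C e" "Cod C e = Dom C m" "m \<cdot> e = f i" "monic C m"
      using is_image_factor[OF m] by blast
    then have "Cod C m = P i" using fi(2) epic_Arr monic_Arr comp_simps(3) by metis
    ultimately show "projective C (P i)" by simp
  qed
  ultimately show "torsionfree C n M" using h Z unfolding torsionfree_def by blast
qed

lemma torsionfree_1_iff: "torsionfree C 1 M \<longleftrightarrow> (\<exists>X. approximation_step C M X)"
proof
  assume "torsionfree C 1 M"
  then obtain P f where h: "P 0 = M" "torsionfree_data 1 P f"
    using torsionfree_iff_data[OF order_refl] by blast
  then have "monic C (f 1)" "left_projective_approximation C (f 1)" "Dom C (f 1) = M"
    using monic_images_approximation_iff[of "f 1"] unfolding torsionfree_data_def by (auto simp: in_Hom)
  then show "\<exists>X. approximation_step C M X"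
    using approximation_sequence_of_monic unfolding approximation_step_def by metis
next
  assume "\<exists>X. approximation_step C M X"
  then obtain X k p where k: "proj_sequence C k p M X" "left_projective_approximation C k"
    unfolding approximation_step_def approximation_sequence_def by blast
  note K = proj_sequenceD[OF k(1)]
  have "torsionfree_data 1 (\<lambda>i. if i = 0 then M else Cod C k) (\<lambda>i. k)"
    unfolding torsionfree_data_def using K monic_images_approximation_iff[OF K(11)] k(2)
    by (auto simp: in_Hom)
  then show "torsionfree C 1 M"
    unfolding torsionfree_iff_data[OF order_refl]
    by (intro exI[of _ "\<lambda>i. if i = 0 then M else Cod C k"] exI[of _ "\<lambda>i. k"]) simp
qed

text \<open>Cutting at the image \<open>m\<close> of the second arrow leaves a first step followed
  by a shorter sequence that starts with \<open>m\<close>. Conversely a step and a shorter sequence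
  are spliced by composing \<open>p\<close> with the first arrow of the latter.\<close>

lemma torsionfree_Suc_iff:
  assumes "n \<ge> 1"
  shows "torsionfree C (Suc n) M \<longleftrightarrow> (\<exists>X. approximation_step C M X \<and> torsionfree C n X)"
proof
  assume "torsionfree C (Suc n) M"
  then obtain P f where P: "P 0 = M" and f: "torsionfree_data (Suc n) P f"
    using torsionfree_iff_data[of "Suc n" M] by auto
  have hom: "f i \<in> Arr C" "Dom C (f i) = P (i - 1)" "Cod C (f i) = P i" if "1 \<le> i" "i \<le> Suc n" for i
    using f that unfolding torsionfree_data_def by (auto simp: in_Hom)
  have f1: "monic C (f 1)" using f unfolding torsionfree_data_def by blast
  have ex: "exact C (f i) (f (Suc i))" if "1 \<le> i" "i \<le> n" for i
    using f that unfolding torsionfree_data_def by auto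
  have ap: "left_projective_approximation C m" if "1 \<le> i" "i \<le> Suc n" "is_image C m (f i)" for i m
    using f that unfolding torsionfree_data_def by auto
  have F1: "Dom C (f 1) = M" "Cod C (f 1) = P 1" using hom(2,3)[of 1] P by simp_all
  have F2: "f (Suc 1) \<in> Arr C" "Dom C (f (Suc 1)) = P 1" "Cod C (f (Suc 1)) = P (Suc 1)"
    using hom[of "Suc 1"] assms by simp_all
  obtain m where m: "is_image C m (f (Suc 1))" using image_ex[OF F2(1)] by blast
  obtain e where e: "epic C e" "Dom C e = Dom C (f (Suc 1))" "Cod C e = Dom C m"
    "m \<cdot> e = f (Suc 1)" "monic C m"
    by (rule is_image_factor[OF m])
  note [simp] = epic_Arr[OF e(1)] monic_Arr[OF e(5)]
  have "is_kernel C (f 1) (f (Suc 1))"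
    using exact_factor[OF monic_is_image[OF f1]] ex[of 1] assms by blast
  then have ke: "is_kernel C (f 1) e"
    using kernel_of_comp_monic[of "f 1" m e] e by simp
  have la: "left_projective_approximation C (f 1)"
    using ap[of 1 "f 1"] monic_is_image[OF f1] by simp
  then have "approximation_sequence C (f 1) e M (Dom C m)"
    using ke epic_cokernel[OF e(1) ke] F1 e(3)
    unfolding approximation_sequence_def proj_sequence_def left_projective_approximation_def by simp
  then have step: "approximation_step C M (Dom C m)" unfolding approximation_step_def by blast
  have imf: "is_image C x (f (Suc 1)) \<longleftrightarrow> is_image C x m" for x
    using is_image_comp_epic[OF e(1), of m x] e by simp
  \<comment> \<open>Indices drop by one. The image object \<open>Dom C m\<close> becomes the zeroth
    term, and the mono \<open>m\<close> replaces the second arrow, with the same images by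
    \<open>imf\<close>.\<close>
  define P' where "P' = (\<lambda>i. if i = 0 then Dom C m else P (Suc i))"
  define f' where "f' = (\<lambda>i. if i = 1 then m else f (Suc i))"
  have codm: "Cod C m = P (Suc 1)"
    using F2(3) comp_simps(3)[of e m] e(3,4) by simp
  have "torsionfree_data n P' f'"
    unfolding torsionfree_data_def
  proof (intro conjI ballI)
    fix i assume i: "i \<in> {1..n}"
    show "f' i \<in> Hom C (P' (i - 1)) (P' i)"
      using hom[of "Suc i"] i codm by (auto simp: f'_def P'_def in_Hom)
    show "\<forall>m. is_image C m (f' i) \<longrightarrow> left_projective_approximation C m"
      using ap[of "Suc i"] i imf by (auto simp: f'_def)
  next
    show "monic C (f' 1)" by (simp add: f'_def e)
  next
    fix i assume i: "i \<in> {1..<n}"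
    show "exact C (f' i) (f' (Suc i))"
    proof (cases "i = 1")
      case True
      have "is_kernel C m (f (Suc (Suc 1)))"
        using exact_factor[OF m] ex[of "Suc 1"] i True by auto
      then have "exact C m (f (Suc (Suc 1)))"
        using exact_factor[OF monic_is_image[OF e(5)]] by blast
      then show ?thesis using True by (simp add: f'_def)
    next
      case False
      then show ?thesis using ex[of "Suc i"] i by (simp add: f'_def)
    qed
  qed
  then have "torsionfree C n (Dom C m)"
    unfolding torsionfree_iff_data[OF assms] by (intro exI[of _ P'] exI[of _ f']) (simp add: P'_def)
  then show "\<exists>X. approximation_step C M X \<and> torsionfree C n X" using step by blast
next
  assume "\<exists>X. approximation_step C M X \<and> torsionfree C n X"
  then obtain X k p P f where k: "proj_sequence C k p M X" "left_projective_approximation C k"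
    and P: "P 0 = X" and f: "torsionfree_data n P f"
    unfolding approximation_step_def approximation_sequence_def torsionfree_iff_data[OF assms] by blast
  note K = proj_sequenceD[OF k(1)]
  note [simp] = K(1-8)
  have hom: "f i \<in> Arr C" "Dom C (f i) = P (i - 1)" "Cod C (f i) = P i" if "1 \<le> i" "i \<le> n" for i
    using f that unfolding torsionfree_data_def by (auto simp: in_Hom)
  have f1: "monic C (f 1)" using f unfolding torsionfree_data_def by blast
  have ex: "exact C (f i) (f (Suc i))" if "1 \<le> i" "i < n" for i
    using f that unfolding torsionfree_data_def by auto
  have ap: "left_projective_approximation C m" if "1 \<le> i" "i \<le> n" "is_image C m (f i)" for i m
    using f that unfolding torsionfree_data_def by auto
  have F: "f 1 \<in> Arr C" "Dom C (f 1) = X" "Cod C (f 1) = P 1"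
    using hom[OF order_refl assms] P by simp_all
  have imf: "is_image C x (f 1 \<cdot> p) \<longleftrightarrow> is_image C x (f 1)" for x
    using is_image_comp_epic[OF K(12), of "f 1" x] F by simp
  \<comment> \<open>Indices rise by one, and the splice \<open>f 1 \<cdot> p\<close> takes the place
    of \<open>f 1\<close> at position 2.\<close>
  define P' where "P' = (\<lambda>i. if i = 0 then M else if i = 1 then Cod C k else P (i - 1))"
  define f' where "f' = (\<lambda>i. if i = 1 then k else if i = 2 then f 1 \<cdot> p else f (i - 1))"
  have "torsionfree_data (Suc n) P' f'"
    unfolding torsionfree_data_def
  proof (intro conjI ballI)
    fix i assume i: "i \<in> {1..Suc n}"
    then consider "i = 1" | "i = 2" | "i > 2" by force
    note cases = this
    from cases show "f' i \<in> Hom C (P' (i - 1)) (P' i)"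
      using hom[of "i - 1"] i F by cases (auto simp: f'_def P'_def in_Hom)
    from cases show "\<forall>m. is_image C m (f' i) \<longrightarrow> left_projective_approximation C m"
      using ap[of "i - 1"] i imf monic_images_approximation_iff[OF K(11)] k(2)
      by cases (auto simp: f'_def)
  next
    show "monic C (f' 1)" by (simp add: f'_def K)
  next
    fix i assume i: "i \<in> {1..<Suc n}"
    then consider "i = 1" | "i = 2" "n > 1" | "i > 2" by force
    then show "exact C (f' i) (f' (Suc i))"
    proof cases
      case 1
      have "is_kernel C k (f 1 \<cdot> p)" by (rule kernel_comp_monic[OF K(9) f1]) (use F in simp)
      then have "exact C k (f 1 \<cdot> p)" using exact_factor[OF monic_is_image[OF K(11)]] by blast
      then show ?thesis using 1 by (simp add: f'_def)
    next
      case 2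
      have "is_kernel C (f 1) (f (Suc 1))"
        using exact_factor[OF monic_is_image[OF f1]] ex[of 1] 2 by blast
      moreover have "is_image C (f 1) (f 1 \<cdot> p)" using imf monic_is_image[OF f1] by blast
      ultimately have "exact C (f 1 \<cdot> p) (f (Suc 1))" unfolding exact_def by blast
      then show ?thesis using 2 by (simp add: f'_def numeral_2_eq_2)
    next
      case 3
      then show ?thesis using ex[of "i - 1"] i by (simp add: f'_def)
    qed
  qed
  then show "torsionfree C (Suc n) M"
    using torsionfree_iff_data[of "Suc n" M] by (force simp: P'_def)
qed

lemma torsionfree_iff_relpowp:
  assumes "n \<ge> 1"
  shows "torsionfree C n M \<longleftrightarrow> (\<exists>L. (approximation_step C ^^ n) M L)"
  using assms
proof (induction n arbitrary: M rule: dec_induct)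
  case base
  show ?case unfolding relpowp_1 by (rule torsionfree_1_iff)
next
  case (step n)
  then show ?case
    by (metis torsionfree_Suc_iff relpowp_Suc_D2 relpowp_Suc_I2)
qed

end

section \<open>Syzygies and the left orthogonal of the projectives\<close>

text \<open>Extension against a single target \<open>Y\<close>. For the first map of a
  \<open>proj_sequence\<close> ending in \<open>X\<close> it expresses that the first Ext group of
  \<open>X\<close> with values in \<open>Y\<close> vanishes.\<close>

definition left_extendable :: "('o, 'm) addcat \<Rightarrow> 'm \<Rightarrow> 'o \<Rightarrow> bool" where
  "left_extendable C k Y \<longleftrightarrow> (\<forall>g \<in> Hom C (Dom C k) Y. \<exists>h \<in> Hom C (Cod C k) Y. h \<cdot>\<^bsub>C\<^esub> k = g)"

text \<open>A trivial quotient has \<open>N\<close> as its only coset, and the coset of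
  \<open>a\<close> contains \<open>a\<close>. Taking \<open>N\<close> to be a subset containing the
  unit means that, for coboundaries, only the zero arrow and the inclusion in the cocycles have to
  be checked.\<close>

lemma (in group) trivial_group_subgroup_Mod_iff:
  assumes H: "subgroup H G" and N: "\<one> \<in> N" "N \<subseteq> H"
  shows "trivial_group (G\<lparr>carrier := H\<rparr> Mod N) \<longleftrightarrow> N = H"
proof
  let ?H = "G\<lparr>carrier := H\<rparr>"
  have grp: "group ?H" by (rule subgroup.subgroup_is_group[OF H group_axioms])
  assume "trivial_group (?H Mod N)"
  then have triv: "rcosets\<^bsub>?H\<^esub> N = {N}"
    by (auto simp: trivial_group_def FactGroup_def)
  have "a \<in> N" if a: "a \<in> H" for a
  proof -
    have "N #>\<^bsub>?H\<^esub> a \<in> rcosets\<^bsub>?H\<^esub> N" using a by (auto simp: RCOSETS_def)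
    then have "N #>\<^bsub>?H\<^esub> a = N" using triv by blast
    moreover have "\<one> \<otimes> a \<in> N #>\<^bsub>?H\<^esub> a" using N(1) by (auto simp: r_coset_def)
    ultimately show ?thesis using a subgroup.mem_carrier[OF H] by simp
  qed
  then show "N = H" using N(2) by blast
next
  let ?H = "G\<lparr>carrier := H\<rparr>"
  have grp: "group ?H" by (rule subgroup.subgroup_is_group[OF H group_axioms])
  assume eq: "N = H"
  have nrm: "N \<lhd> ?H" using group.normal_invI[OF grp group.subgroup_self[OF grp]]
    group.is_monoid[OF grp] group.inv_closed[OF grp] monoid.m_closed[OF group.is_monoid[OF grp]]
    by (simp add: eq)
  have "rcosets\<^bsub>?H\<^esub> N = {N}"
  proof -
    have "N #>\<^bsub>?H\<^esub> a = N" if "a \<in> carrier ?H" for a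
      using group.coset_join2[OF grp that group.subgroup_self[OF grp]] that by (simp add: eq)
    moreover have "\<one> \<in> carrier ?H" using subgroup.one_closed[OF H] by simp
    ultimately show ?thesis unfolding RCOSETS_def by blast
  qed
  then show "trivial_group (?H Mod N)"
    using normal.factorgroup_is_group[OF nrm] by (simp add: trivial_group_def FactGroup_def)
qed

section \<open>Vanishing of Ext as extension along syzygy inclusions\<close>

context abelian_category
begin

lemma left_projective_approximation_iff:
  assumes "k \<in> Arr C" "projective C (Cod C k)"
  shows "left_projective_approximation C k \<longleftrightarrow> (\<forall>Q. projective C Q \<longrightarrow> left_extendable C k Q)"
  using assms unfolding left_projective_approximation_def left_extendable_def by blast

lemma precomp_group_hom:
  assumes "d \<in> Hom C X Y" "Q \<in> Ob C"
  shows "group_hom (hom_group C Y Q) (hom_group C X Q) (\<lambda>f. f \<cdot> d)"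
proof -
  have [simp]: "d \<in> Arr C" "Dom C d = X" "Cod C d = Y" using assms by (auto simp: in_Hom)
  have "X \<in> Ob C" "Y \<in> Ob C" using Dom_Ob[of d] Cod_Ob[of d] by simp_all
  then show ?thesis
    using hom_group assms(2)
    by (auto simp: group_hom_def group_hom_axioms_def hom_def hom_group_simps in_Hom distrib_right)
qed

lemma mem_kernel_precomp:
  "f \<in> kernel (hom_group C Y Q) (hom_group C X Q) (\<lambda>f. f \<cdot> d) \<longleftrightarrow>
     f \<in> Hom C Y Q \<and> f \<cdot> d = Zero C X Q"
  by (simp add: kernel_def hom_group_simps)

text \<open>Since \<open>p''\<close> is epic and \<open>p'\<close> is a cokernel of
  \<open>k'\<close>, the cocycles are the arrows \<open>g \<cdot> p'\<close> with \<open>g\<close>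
  on \<open>K\<close>; the coboundaries are those where \<open>g\<close> has the form
  \<open>h \<cdot> k\<close>. As \<open>p'\<close> is epic, equality means that every
  \<open>g\<close> extends along \<open>k\<close>. No indices occur, so the lemma serves both
  resolutions and two-sided complexes.\<close>

lemma hom_cocycles_eq_coboundaries_iff:
  assumes s: "proj_sequence C (k :: 'b) p K X" and s': "proj_sequence C k' p' K' K"
    and s'': "proj_sequence C k'' p'' K'' K'"
    and Y: "Y \<in> Ob C"
  shows "kernel (hom_group C (Dom C p') Y) (hom_group C (Dom C p'') Y) (\<lambda>f. f \<cdot> (k' \<cdot> p''))
      = (\<lambda>f. f \<cdot> (k \<cdot> p')) ` Hom C (Dom C p) Y \<longleftrightarrow> left_extendable C k Y"
    and "(\<lambda>f. f \<cdot> (k \<cdot> p')) ` Hom C (Dom C p) Y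
      \<subseteq> kernel (hom_group C (Dom C p') Y) (hom_group C (Dom C p'') Y) (\<lambda>f. f \<cdot> (k' \<cdot> p''))"
proof -
  note S = proj_sequenceD[OF s] and S' = proj_sequenceD[OF s'] and S'' = proj_sequenceD[OF s'']
  note [simp] = S(1-8) S'(1-8) S''(1-8) Y
  let ?Z = "kernel (hom_group C (Dom C p') Y) (hom_group C (Dom C p'') Y) (\<lambda>f. f \<cdot> (k' \<cdot> p''))"
  let ?B = "(\<lambda>f. f \<cdot> (k \<cdot> p')) ` Hom C (Dom C p) Y"
  have Z: "f \<in> ?Z \<longleftrightarrow> (\<exists>g \<in> Hom C K Y. f = g \<cdot> p')" for f
  proof
    assume "f \<in> ?Z"
    then have [simp]: "f \<in> Arr C" "Dom C f = Dom C p'" "Cod C f = Y"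
      and eq: "f \<cdot> (k' \<cdot> p'') = Zero C (Dom C p'') Y"
      by (auto simp: mem_kernel_precomp in_Hom)
    have "f \<cdot> k' = Zero C (Cod C p'') Y"
      by (rule epic_Zero[OF S''(12)]) (use eq in \<open>simp_all add: assoc\<close>)
    then obtain g where "g \<in> Arr C" "Dom C g = K" "Cod C g = Y" "g \<cdot> p' = f"
      using cokernel_ex_factor[OF S'(10), of f] by auto
    then show "\<exists>g \<in> Hom C K Y. f = g \<cdot> p'" by (auto simp: in_Hom)
  next
    assume "\<exists>g \<in> Hom C K Y. f = g \<cdot> p'"
    then obtain g where [simp]: "g \<in> Arr C" "Dom C g = K" "Cod C g = Y" and f: "f = g \<cdot> p'"
      by (auto simp: in_Hom)
    have "(g \<cdot> p') \<cdot> (k' \<cdot> p'') = g \<cdot> ((p' \<cdot> k') \<cdot> p'')" by (simp add: assoc del: S'(6))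
    also have "\<dots> = Zero C (Dom C p'') Y" by simp
    finally show "f \<in> ?Z" by (simp add: mem_kernel_precomp in_Hom f)
  qed
  have B: "f \<in> ?B \<longleftrightarrow> (\<exists>h \<in> Hom C (Dom C p) Y. f = (h \<cdot> k) \<cdot> p')" for f
  proof -
    have "h \<cdot> (k \<cdot> p') = (h \<cdot> k) \<cdot> p'" if "h \<in> Hom C (Dom C p) Y" for h
      using that by (simp add: in_Hom assoc)
    then show ?thesis by auto
  qed
  have hk: "h \<cdot> k \<in> Hom C K Y" if "h \<in> Hom C (Dom C p) Y" for h
    using that by (simp add: in_Hom)
  show sub: "?B \<subseteq> ?Z"
    using Z B hk by blast
  have cancel: "g = h \<cdot> k" if "g \<cdot> p' = (h \<cdot> k) \<cdot> p'" "g \<in> Hom C K Y" "h \<in> Hom C (Dom C p) Y" for g h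
    by (rule epic_cancel[OF S'(12) that(1)]) (use that in \<open>simp_all add: in_Hom\<close>)
  have "?Z \<subseteq> ?B \<longleftrightarrow> (\<forall>g \<in> Hom C K Y. \<exists>h \<in> Hom C (Dom C p) Y. g \<cdot> p' = (h \<cdot> k) \<cdot> p')"
    unfolding subset_iff Z B by blast
  also have "\<dots> \<longleftrightarrow> left_extendable C k Y"
    unfolding left_extendable_def using cancel by simp metis
  finally show "?Z = ?B \<longleftrightarrow> left_extendable C k Y" using sub by blast
qed

text \<open>Dimension shifting: degree \<open>Suc i\<close> is governed by the three consecutive
  syzygy sequences that begin with the one ending in \<open>K i\<close>.\<close>

lemma trivial_hom_cohomology_iff:
  assumes s: "\<And>i. proj_sequence C (k i) (p i) (K (Suc i)) (K i)" and Y: "Y \<in> Ob C"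
  shows "trivial_group (hom_cohomology C (\<lambda>i. Dom C (p i)) (\<lambda>i. k i \<cdot> p (Suc i)) Y (Suc i)) \<longleftrightarrow>
    left_extendable C (k i) Y"
proof -
  note S = proj_sequenceD[OF s]
  let ?P = "\<lambda>i. Dom C (p i)" and ?d = "\<lambda>i. k i \<cdot> p (Suc i)"
  have [simp]: "?P i \<in> Ob C" for i using S by simp
  have d: "?d i \<in> Hom C (?P (Suc i)) (?P i)" for i using S by (simp add: in_Hom)
  note iff = hom_cocycles_eq_coboundaries_iff[OF s[of i] s[of "Suc i"] s[of "Suc (Suc i)"] Y]
  let ?Z = "hom_cocycles C ?P ?d Y (Suc i)" and ?B = "hom_coboundaries C ?P ?d Y (Suc i)"
  have eqs: "?Z = kernel (hom_group C (?P (Suc i)) Y) (hom_group C (?P (Suc (Suc i))) Y) (\<lambda>f. f \<cdot> ?d (Suc i))"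
    "?B = (\<lambda>f. f \<cdot> ?d i) ` Hom C (?P i) Y"
    by (simp_all add: hom_cocycles_def hom_coboundaries_def)
  have sub: "subgroup ?Z (hom_group C (?P (Suc i)) Y)"
    unfolding eqs by (rule group_hom.subgroup_kernel[OF precomp_group_hom[OF d Y]])
  have "Zero C (?P i) Y \<cdot> ?d i = Zero C (?P (Suc i)) Y"
    using d[of i] Y by (simp add: in_Hom)
  moreover have "Zero C (?P i) Y \<in> Hom C (?P i) Y" using Y by (simp add: in_Hom)
  ultimately have "\<one>\<^bsub>hom_group C (?P (Suc i)) Y\<^esub> \<in> ?B"
    unfolding eqs hom_group_simps by (metis imageI)
  moreover have "?B \<subseteq> ?Z" using iff(2) unfolding eqs .
  ultimately have "trivial_group (hom_cohomology C ?P ?d Y (Suc i)) \<longleftrightarrow> ?B = ?Z"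
    unfolding hom_cohomology_def
    by (intro group.trivial_group_subgroup_Mod_iff[OF hom_group sub]) (simp_all add: Y)
  moreover have "?Z = ?B \<longleftrightarrow> left_extendable C (k i) Y" unfolding eqs by (rule iff(1))
  ultimately show ?thesis by blast
qed

text \<open>Each differential is factored through a kernel of the preceding map of the augmented
  resolution; the kernels are the syzygies \<open>K (Suc i)\<close>.\<close>

lemma resolution_syzygies:
  assumes "projective_resolution C X (P, d, e)"
  obtains k p K where "K 0 = X" "\<And>i. proj_sequence C (k i) (p i) (K (Suc i)) (K i)"
    "P = (\<lambda>i. Dom C (p i))" "d = (\<lambda>i. k i \<cdot> p (Suc i))"
proof -
  have P: "\<And>i. projective C (P i)" and e: "e \<in> Arr C" "Dom C e = P 0" "Cod C e = X"
    and d: "\<And>i. d i \<in> Arr C" "\<And>i. Dom C (d i) = P (Suc i)" "\<And>i. Cod C (d i) = P i"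
    and ex: "exact C (d 0) e" "\<And>i. exact C (d (Suc i)) (d i)"
    using assms by (auto simp: projective_resolution_def in_Hom)
  have ep: "epic C e"
    using assms exact_to_zero_iff by (auto simp: projective_resolution_def)
  \<comment> \<open>Listing the augmentation before the differentials gives \<open>b i\<close> the
    domain \<open>P i\<close>, so exactness at \<open>P i\<close> reads
    \<open>exact C (d i) (b i)\<close> for every \<open>i\<close>.\<close>
  define b where "b = (\<lambda>i. case i of 0 \<Rightarrow> e | Suc j \<Rightarrow> d j)"
  have b: "b i \<in> Arr C" "Dom C (b i) = P i" for i
    using e d by (auto simp: b_def split: nat.split)
  have exb: "exact C (d i) (b i)" for i using ex by (auto simp: b_def split: nat.split)
  define k where "k = (\<lambda>i. SOME k. is_kernel C k (b i))"
  have k: "is_kernel C (k i) (b i)" for i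
    unfolding k_def using ex_kernel[OF b(1)] by (rule someI_ex)
  have "\<exists>q. epic C q \<and> Dom C q = P (Suc i) \<and> Cod C q = Dom C (k i) \<and> k i \<cdot> q = d i" for i
    by (rule exact_kernel[OF exb k]) (use d in auto)
  then obtain q where q: "\<And>i. epic C (q i)" "\<And>i. Dom C (q i) = P (Suc i)"
    "\<And>i. Cod C (q i) = Dom C (k i)" "\<And>i. k i \<cdot> q i = d i"
    by metis
  define p where "p = (\<lambda>i. case i of 0 \<Rightarrow> e | Suc j \<Rightarrow> q j)"
  define K where "K = (\<lambda>i. case i of 0 \<Rightarrow> X | Suc j \<Rightarrow> Dom C (k j))"
  have p: "epic C (p i)" "Dom C (p i) = P i" "Cod C (p i) = K i" for i
    using e ep q by (auto simp: p_def K_def split: nat.split)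
  have kp: "is_kernel C (k i) (p i)" for i
  proof (cases i)
    case 0
    then show ?thesis using k[of 0] by (simp add: p_def b_def)
  next
    case (Suc j)
    \<comment> \<open>Here \<open>b i\<close> is the differential \<open>d j\<close>; removing its
      monic factor \<open>k j\<close> leaves the epi \<open>q j\<close> with the same
      kernel.\<close>
    then have "is_kernel C (k i) (k j \<cdot> q j)" using k[of i] q by (simp add: b_def)
    then show ?thesis
      using kernel_of_comp_monic[OF _ kernel_monic[OF k[of j]], of "k i" "q j"] q epic_Arr Suc
      by (simp add: p_def)
  qed
  have "proj_sequence C (k i) (p i) (K (Suc i)) (K i)" for i
    using kp[of i] epic_cokernel[OF p(1) kp] p P kernel_simps(3)[OF kp[of i]]
    by (simp add: proj_sequence_def K_def)
  moreover have "K 0 = X" by (simp add: K_def)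
  moreover have "P = (\<lambda>i. Dom C (p i))" "d = (\<lambda>i. k i \<cdot> p (Suc i))"
    using p q by (auto simp: p_def)
  ultimately show ?thesis by (intro that)
qed

lemma ex_projective_resolution:
  assumes "enough_projectives C" "X \<in> Ob C"
  shows "\<exists>R. projective_resolution C X R"
proof -
  have "\<exists>k p K. proj_sequence C k p K Y" if "Y \<in> Ob C" for Y
  proof -
    have "\<exists>P e. projective C P \<and> e \<in> Hom C P Y \<and> epic C e"
      using assms(1) that by (simp add: enough_projectives_def)
    then obtain P e where e: "projective C P" "e \<in> Hom C P Y" "epic C e" by blast
    obtain k where k: "is_kernel C k e" using ex_kernel[OF epic_Arr[OF e(3)]] by blast
    then have "proj_sequence C k e (Dom C k) Y"
      using e epic_cokernel[OF e(3) k] kernel_simps(3)[OF k]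
      by (simp add: proj_sequence_def in_Hom)
    then show ?thesis by blast
  qed
  \<comment> \<open>A syzygy is chosen for all objects at once, so that the whole resolution arises
    by iterating \<Omega>.\<close>
  then obtain k p \<Omega> where \<Omega>: "\<And>Y. Y \<in> Ob C \<Longrightarrow> proj_sequence C (k Y) (p Y) (\<Omega> Y) Y"
    by metis
  define K where "K = (\<lambda>i. (\<Omega> ^^ i) X)"
  have K: "K i \<in> Ob C" for i
    by (induction i) (use assms proj_sequenceD(7)[OF \<Omega>] in \<open>auto simp: K_def\<close>)
  have s: "proj_sequence C (k (K i)) (p (K i)) (K (Suc i)) (K i)" for i
    using \<Omega>[OF K[of i]] by (simp add: K_def)
  note S = proj_sequenceD[OF s]
  have im: "is_image C (k (K i)) (k (K i) \<cdot> p (K (Suc i)))" for i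
    by (rule is_imageI[OF S(11) S(12)]) (simp add: S)
  obtain Z where Z: "zero_object C Z" using ex_zero_object by blast
  have e: "p (K 0) \<in> Hom C (Dom C (p (K 0))) X"
    using S(2,5)[of 0] by (simp add: K_def in_Hom)
  have "exact C (p (K 0)) (Zero C X Z)" using exact_to_zero_iff[OF Z e] S(12) by blast
  moreover have "exact C (k (K 0) \<cdot> p (K (Suc 0))) (p (K 0))"
    using im S(9) unfolding exact_def by blast
  moreover have "exact C (k (K (Suc i)) \<cdot> p (K (Suc (Suc i)))) (k (K i) \<cdot> p (K (Suc i)))" for i
    using im kernel_comp_monic[OF S(9) S(11)] S unfolding exact_def by metis
  ultimately have "projective_resolution C X
      (\<lambda>i. Dom C (p (K i)), \<lambda>i. k (K i) \<cdot> p (K (Suc i)), p (K 0))"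
    using Z e S unfolding projective_resolution_def by (auto simp: in_Hom)
  then show ?thesis by blast
qed

text \<open>The resolution that is cut up is the very one selected inside \<open>Ext\<close>, so
  different resolutions need not be compared here.\<close>

lemma ex_syzygies:
  assumes "enough_projectives C" "X \<in> Ob C"
  obtains k p K where "K 0 = X" "\<And>i. proj_sequence C (k i) (p i) (K (Suc i)) (K i)"
    "X \<in> left_perp_projectives C \<longleftrightarrow> (\<forall>i. left_projective_approximation C (k i))"
proof -
  obtain P d e where R: "(SOME R. projective_resolution C X R) = (P, d, e)"
    by (metis prod_cases3)
  have "projective_resolution C X (P, d, e)"
    using someI_ex[OF ex_projective_resolution[OF assms]] unfolding R .
  then obtain k p K where K: "K 0 = X" and s: "\<And>i. proj_sequence C (k i) (p i) (K (Suc i)) (K i)"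
    and Pd: "P = (\<lambda>i. Dom C (p i))" "d = (\<lambda>i. k i \<cdot> p (Suc i))"
    by (rule resolution_syzygies) blast
  note S = proj_sequenceD[OF s]
  have "trivial_group (Ext C (Suc i) X Q) \<longleftrightarrow> left_extendable C (k i) Q" if "projective C Q" for i Q
    using trivial_hom_cohomology_iff[of k p K, OF s, of Q i] that
    by (simp add: Ext_def R Pd projective_def)
  moreover have "X \<in> left_perp_projectives C \<longleftrightarrow>
      (\<forall>i Q. projective C Q \<longrightarrow> trivial_group (Ext C (Suc i) X Q))"
    using assms(2) unfolding left_perp_projectives_def
    by (auto simp: Suc_le_eq gr0_conv_Suc)
  moreover have "left_projective_approximation C (k i) \<longleftrightarrow>
      (\<forall>Q. projective C Q \<longrightarrow> left_extendable C (k i) Q)" for i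
    using left_projective_approximation_iff S by simp
  ultimately have "X \<in> left_perp_projectives C \<longleftrightarrow> (\<forall>i. left_projective_approximation C (k i))"
    by blast
  then show ?thesis by (rule that[OF K s])
qed

end

section \<open>Gorenstein projective objects\<close>

context abelian_category
begin

text \<open>The cocycles of a totally acyclic complex form the chain: acyclicity gives the short
  exact sequences, and acyclicity under Hom into projectives gives the approximation property of the
  inclusions.\<close>

lemma gorenstein_projective_chain:
  assumes "M \<in> gorenstein_projectives C"
  obtains Z :: "int \<Rightarrow> 'a" where "\<And>i. approximation_step C (Z i) (Z (i + 1))" "isomorphic C M (Z 0)"
proof -
  obtain P d k0 where t: "totally_acyclic C P d" and k0: "is_kernel C k0 (d 0)"
    and iso: "isomorphic C M (Dom C k0)"
    using assms unfolding gorenstein_projectives_def by blast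
  have P: "projective C (P i)" and d: "d i \<in> Arr C" "Dom C (d i) = P i" "Cod C (d i) = P (i + 1)"
    and ex: "exact C (d i) (d (i + 1))" for i
    using t by (auto simp: totally_acyclic_def in_Hom)
  have [simp]: "P i \<in> Ob C" for i using P by (simp add: projective_def)
  have tot: "\<exists>h \<in> Hom C (P (i + 2)) Q. g = h \<cdot> d (i + 1)"
    if "projective C Q" "g \<in> Hom C (P (i + 1)) Q" "g \<cdot> d i = Zero C (P i) Q" for g Q i
  proof -
    have "g \<in> (\<lambda>f. f \<cdot> d (i + 1)) ` Hom C (P (i + 2)) Q"
      using t that unfolding totally_acyclic_def by (simp add: mem_kernel_precomp)
    then show ?thesis by blast
  qed
  \<comment> \<open>Kernels are chosen so that the one at 0 is the given \<open>k0\<close>, to which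
    \<open>iso\<close> refers.\<close>
  have "\<exists>k. is_kernel C k (d i) \<and> (i = 0 \<longrightarrow> k = k0)" for i
    using ex_kernel[OF d(1)] k0 by (cases "i = 0") auto
  then obtain k where k: "\<And>i. is_kernel C (k i) (d i)" "k 0 = k0" by metis
  have "\<exists>q. epic C q \<and> Dom C q = P i \<and> Cod C q = Dom C (k (i + 1)) \<and> k (i + 1) \<cdot> q = d i" for i
    by (rule exact_kernel[OF ex k(1)]) (use d in auto)
  then obtain q where q: "\<And>i. epic C (q i)" "\<And>i. Dom C (q i) = P i"
    "\<And>i. Cod C (q i) = Dom C (k (i + 1))" "\<And>i. k (i + 1) \<cdot> q i = d i"
    by metis
  note km = kernel_monic[OF k(1)]
  have [simp]: "q i \<in> Arr C" "k i \<in> Arr C" "Cod C (k i) = P i" for i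
    using epic_Arr[OF q(1)] kernel_simps[OF k(1)] d by auto
  have kq: "is_kernel C (k i) (q i)" for i
    by (rule kernel_of_comp_monic[OF _ km[of "i + 1"]]) (simp_all add: q k(1))
  have "approximation_step C (Dom C (k i)) (Dom C (k (i + 1)))" for i
  proof -
    have "proj_sequence C (k i) (q i) (Dom C (k i)) (Dom C (k (i + 1)))"
      using kq epic_cokernel[OF q(1) kq] P q(3) by (simp add: proj_sequence_def)
    moreover have "left_projective_approximation C (k i)"
      unfolding left_projective_approximation_def
    proof (intro conjI allI impI ballI)
      fix Q g assume Q: "projective C Q" and "g \<in> Hom C (Dom C (k i)) Q"
      then have [simp]: "g \<in> Arr C" "Dom C g = Dom C (k i)" "Cod C g = Q" by (auto simp: in_Hom)
      have [simp]: "Q \<in> Ob C" using Q by (simp add: projective_def)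
      \<comment> \<open>The Hom complex is used at \<open>P (i - 1)\<close>, that is
        \<open>P (j + 1)\<close>: there \<open>g \<cdot> q (j + 1)\<close> is a cocycle, and the
        \<open>h\<close> producing it as a coboundary is defined on \<open>P i\<close>.\<close>
      define j where "j = i - 2"
      have i: "i = j + 2" "j + 1 + 1 = j + 2" by (simp_all add: j_def)
      note q1 = q[of "j + 1", unfolded i(2)]
      note [simp] = q1(2,3)
      have dq: "d j = k (j + 1) \<cdot> q j" using q(4) by simp
      have "q (j + 1) \<cdot> d j = (q (j + 1) \<cdot> k (j + 1)) \<cdot> q j"
        unfolding dq by (rule assoc[symmetric]) (simp_all add: q)
      also have "\<dots> = Zero C (P j) (Dom C (k i))"
        using kernel_simps(4)[OF kq[of "j + 1"]] q(2,3)[of j] by (simp add: i)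
      finally have "(g \<cdot> q (j + 1)) \<cdot> d j = Zero C (P j) Q"
        using d[of j] by (simp add: assoc i)
      moreover have "g \<cdot> q (j + 1) \<in> Hom C (P (j + 1)) Q" by (simp add: in_Hom i)
      ultimately obtain h where h: "h \<in> Hom C (P (j + 2)) Q" "g \<cdot> q (j + 1) = h \<cdot> d (j + 1)"
        using tot[OF Q, of "g \<cdot> q (j + 1)" j] by blast
      have [simp]: "h \<in> Arr C" "Dom C h = P (j + 2)" "Cod C h = Q" using h(1) by (auto simp: in_Hom)
      have "h \<cdot> k i = g"
        by (rule epic_cancel[OF q1(1)]) (simp_all add: assoc h(2) q1(4) i)
      then show "\<exists>h \<in> Hom C (Cod C (k i)) Q. h \<cdot> k i = g"
        using h(1) by (auto simp: i)
    qed (use P in simp_all)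
    ultimately show ?thesis unfolding approximation_step_def approximation_sequence_def by blast
  qed
  moreover have "isomorphic C M (Dom C (k 0))" using iso k(2) by simp
  ultimately show ?thesis using that[of "\<lambda>i. Dom C (k i)"] by blast
qed

text \<open>Splicing the steps gives differentials \<open>k (i + 1) \<cdot> p i\<close>, whose
  kernels are the \<open>k i\<close>; in particular \<open>Z 0\<close> is the zeroth
  cocycle.\<close>

lemma chain_gorenstein_projective:
  fixes Z :: "int \<Rightarrow> 'a"
  assumes "\<And>i. approximation_step C (Z i) (Z (i + 1))"
  shows "Z 0 \<in> gorenstein_projectives C"
proof -
  obtain k p where "\<And>i. approximation_sequence C (k i) (p i) (Z i) (Z (i + 1))"
    using assms unfolding approximation_step_def by metis
  then have s: "\<And>i. proj_sequence C (k i) (p i) (Z i) (Z (i + 1))"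
    and la: "\<And>i. left_projective_approximation C (k i)"
    by (auto simp: approximation_sequence_def)
  note S = proj_sequenceD[OF s]
  note [simp] = S(1-8)
  define P where "P = (\<lambda>i. Dom C (p i))"
  define d where "d = (\<lambda>i. k (i + 1) \<cdot> p i)"
  have ker: "is_kernel C (k i) (d i)" for i
    unfolding d_def by (rule kernel_comp_monic[OF S(9) S(11)]) simp
  have im: "is_image C (k (i + 1)) (d i)" for i
    unfolding d_def by (rule is_imageI[OF S(11) S(12)]) simp
  have d: "d i \<in> Hom C (P i) (P (i + 1))" for i by (simp add: d_def P_def in_Hom)
  have "(\<lambda>f. f \<cdot> d (i + 1)) ` Hom C (P (i + 2)) Q =
      kernel (hom_group C (P (i + 1)) Q) (hom_group C (P i) Q) (\<lambda>f. f \<cdot> d i)" if "projective C Q" for Q i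
  proof -
    \<comment> \<open>Acyclicity of the Hom complex at \<open>P (i + 1)\<close> amounts to extension
      along \<open>k (i + 2)\<close>.\<close>
    have "left_extendable C (k (i + 1 + 1)) Q"
      using la left_projective_approximation_iff[of "k (i + 1 + 1)"] S that by simp
    moreover have "Q \<in> Ob C" using that by (simp add: projective_def)
    ultimately show ?thesis
      using hom_cocycles_eq_coboundaries_iff(1)[OF s[of "i + 1 + 1"] s[of "i + 1"] s[of i], of Q]
      by (simp add: P_def d_def add.assoc)
  qed
  then have "totally_acyclic C P d"
    using d S(13) im ker unfolding totally_acyclic_def exact_def P_def by blast
  moreover have "isomorphic C (Z 0) (Z 0)"
    unfolding isomorphic_def by (intro bexI[of _ "Ident C (Z 0)"]) (simp_all add: in_Hom)
  ultimately show ?thesis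
    using ker[of 0] S(3)[of 0] S(7)[of 0] unfolding gorenstein_projectives_def by force
qed

text \<open>The syzygies of \<open>M\<close> are compared with the left half of its chain: by
  induction \<open>K i\<close> is a stable retract of \<open>Z (- int i)\<close>, and
  \<open>stable_retract_kernel\<close> hands the approximation property on to each
  \<open>k i\<close>.\<close>

lemma gorenstein_projective_left_perp:
  assumes "enough_projectives C"
  shows "gorenstein_projectives C \<subseteq> left_perp_projectives C"
proof
  fix M assume M: "M \<in> gorenstein_projectives C"
  obtain Z :: "int \<Rightarrow> 'a" where Z: "\<And>i. approximation_step C (Z i) (Z (i + 1))" "isomorphic C M (Z 0)"
    using gorenstein_projective_chain[OF M] by blast
  have MO: "M \<in> Ob C" using M by (simp add: gorenstein_projectives_def)
  obtain k p K where K: "K 0 = M" and s: "\<And>i. proj_sequence C (k i) (p i) (K (Suc i)) (K i)"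
    and perp: "M \<in> left_perp_projectives C \<longleftrightarrow> (\<forall>i. left_projective_approximation C (k i))"
    by (rule ex_syzygies[OF assms MO]) blast
  have step: "approximation_sequence C (k i) (p i) (K (Suc i)) (K i) \<and> stable_retract C (K (Suc i)) (Z (- int (Suc i)))"
    if "stable_retract C (K i) (Z (- int i))" for i
  proof -
    have "- int (Suc i) + 1 = - int i" by simp
    then have "approximation_step C (Z (- int (Suc i))) (Z (- int i))" using Z(1) by metis
    then show ?thesis using stable_retract_kernel[OF s _ that] unfolding approximation_step_def by blast
  qed
  have "stable_retract C (K i) (Z (- int i))" for i
  proof (induction i)
    case 0
    show ?case using iso_stable_retract[OF Z(2) proj_sequenceD(13)[OF s[of 0]] MO] K by simp
  next
    case (Suc i)
    then show ?case using step by blast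
  qed
  then show "M \<in> left_perp_projectives C"
    using step perp by (auto simp: approximation_sequence_def)
qed

section \<open>Consequences of the stabilization of the torsionfree classes\<close>

lemma ex_approximation_coresolution:
  assumes "\<And>Y. T Y \<Longrightarrow> \<exists>Y'. approximation_step C Y Y' \<and> T Y'" and "T X"
  obtains W where "W 0 = X" "\<And>i. approximation_step C (W i) (W (Suc i))"
proof -
  have "\<exists>W. \<forall>i. T (W i) \<and> (i = 0 \<longrightarrow> W i = X) \<and> approximation_step C (W i) (W (Suc i))"
    \<comment> \<open>The clause for \<open>i = 0\<close> in the chosen property pins the sequence
      to start at \<open>X\<close>.\<close>
    by (rule dependent_nat_choice[of "\<lambda>i Y. T Y \<and> (i = 0 \<longrightarrow> Y = X)" "\<lambda>i. approximation_step C",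
          unfolded conj_assoc]) (use assms in auto)
  then show ?thesis using that by blast
qed

text \<open>By stabilization an \<open>n\<close>-torsionfree object has a step to another
  \<open>n\<close>-torsionfree object, so the process never stops and yields chains of every
  length.\<close>

lemma torsionfree_stable_implies_all:
  assumes "n \<ge> 1" "torsionfree_objects C n = torsionfree_objects C (n + 1)" "torsionfree C n M"
  shows "m \<ge> 1 \<Longrightarrow> torsionfree C m M"
proof -
  have step: "\<exists>X. approximation_step C Y X \<and> torsionfree C n X" if "torsionfree C n Y" for Y
    using that assms(2) torsionfree_Suc_iff[OF assms(1)] by (auto simp: torsionfree_objects_def)
  have "\<exists>L. (approximation_step C ^^ m) Y L" if "torsionfree C n Y" for m Y
    using that
  proof (induction m arbitrary: Y)
    case (Suc m)
    then show ?case using step relpowp_Suc_I2 by metis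
  qed simp
  then show "m \<ge> 1 \<Longrightarrow> torsionfree C m M" using torsionfree_iff_relpowp assms(3) by blast
qed

lemma relpowp_syzygies:
  assumes "\<And>i. approximation_step C (K (Suc i)) (K i)"
  shows "(approximation_step C ^^ n) (K n) (K 0)"
  by (induction n) (use assms in \<open>auto intro: relpowp_Suc_I2 simp del: relpowp.simps(2)\<close>)

lemma left_perp_gorenstein_projective:
  assumes "enough_projectives C" "n \<ge> 1"
    and T: "torsionfree_objects C n = torsionfree_objects C (n + 1)"
  shows "left_perp_projectives C \<subseteq> gorenstein_projectives C"
proof
  fix X assume X: "X \<in> left_perp_projectives C"
  then have XO: "X \<in> Ob C" by (simp add: left_perp_projectives_def)
  obtain k p K where K: "K 0 = X" and "\<And>i. proj_sequence C (k i) (p i) (K (Suc i)) (K i)"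
    "\<And>i. left_projective_approximation C (k i)"
    using ex_syzygies[OF assms(1) XO] X by metis
  then have s: "\<And>i. approximation_step C (K (Suc i)) (K i)"
    unfolding approximation_step_def approximation_sequence_def by blast
  have Kn: "(approximation_step C ^^ n) (K n) X" using relpowp_syzygies[of K n] s K by simp
  then have "torsionfree C n (K n)" using torsionfree_iff_relpowp[OF assms(2)] by blast
  \<comment> \<open>Length \<open>n + n\<close> lets the chain be split in the middle:
    \<open>n\<close> steps to match those ending in \<open>X\<close>, and \<open>n\<close> further
    ones to hand over to \<open>X\<close>.\<close>
  then have "torsionfree C (n + n) (K n)"
    using torsionfree_stable_implies_all[OF assms(2) T] assms(2) by simp
  then obtain L where "(approximation_step C ^^ (n + n)) (K n) L"
    using torsionfree_iff_relpowp[of "n + n" "K n"] assms(2) by auto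
  then obtain Y where Y: "(approximation_step C ^^ n) (K n) Y" "(approximation_step C ^^ n) Y L"
    unfolding relpowp_add by blast
  obtain F where F: "projective C F" using assms(1) XO unfolding enough_projectives_def by blast
  \<comment> \<open>Both \<open>X\<close> and \<open>Y\<close> end chains of \<open>n\<close> steps
    starting at \<open>K n\<close>, so the comparison begins with the trivial retract.\<close>
  have "stable_retract C (K n) (K n)"
    using stable_retract_refl[OF approximation_step_Ob(1)[OF s[of "n - 1"]] F] assms(2) by simp
  then have "stable_retract C X Y" using relpowp_stable_retract_cokernel Kn Y(1) by blast
  then obtain L' where "(approximation_step C ^^ n) X L'"
    using relpowp_stable_retract[OF _ Y(2)] by blast
  then have tX: "torsionfree C n X" using torsionfree_iff_relpowp[OF assms(2)] by blast
  obtain W where W: "W 0 = X" "\<And>i. approximation_step C (W i) (W (Suc i))"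
  proof (rule ex_approximation_coresolution[of "torsionfree C n", OF _ tX])
    show "\<exists>Y'. approximation_step C Y Y' \<and> torsionfree C n Y'" if "torsionfree C n Y" for Y
      using that T torsionfree_Suc_iff[OF assms(2)] by (auto simp: torsionfree_objects_def)
  qed blast
  \<comment> \<open>The coresolution to the right and the syzygies to the left meet at index 0,
    where \<open>W 0\<close> and \<open>K 0\<close> are both \<open>X\<close>.\<close>
  define Z :: "int \<Rightarrow> 'a" where "Z = (\<lambda>i. if i \<ge> 0 then W (nat i) else K (nat (- i)))"
  have "approximation_step C (Z i) (Z (i + 1))" for i
  proof (cases "i \<ge> 0")
    case True
    then show ?thesis using W(2)[of "nat i"] by (simp add: Z_def nat_add_distrib)
  next
    case False
    then have "nat (- i) = Suc (nat (- (i + 1)))" by linarith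
    then have "Z i = K (Suc (nat (- (i + 1))))" using False by (simp add: Z_def)
    \<comment> \<open>For \<open>i = -1\<close> the successor index is 0, where \<open>Z\<close> is
      given by \<open>W\<close>; this is the seam.\<close>
    moreover have "Z (i + 1) = K (nat (- (i + 1)))"
      using False W(1) K by (cases "i + 1 = 0") (auto simp: Z_def)
    ultimately show ?thesis using s by presburger
  qed
  then have "Z 0 \<in> gorenstein_projectives C" by (rule chain_gorenstein_projective)
  then show "X \<in> gorenstein_projectives C" by (simp add: Z_def W(1))
qed

end

theorem theorem4p4:
  fixes A :: "('o, 'm) addcat" and n :: nat
  assumes "abelian_category A"
    and "enough_projectives A"
    and "n \<ge> 1"
    and "torsionfree_objects A n = torsionfree_objects A (n + 1)"
  shows "torsionfree_objects A n = inf_torsionfree_objects A \<and> weakly_gorenstein A"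
proof
  interpret abelian_category A by fact
  show "torsionfree_objects A n = inf_torsionfree_objects A"
    \<comment> \<open>One inclusion holds for every index by the lemma; the other only uses that
      \<open>n\<close> belongs to the index set of the intersection.\<close>
    using torsionfree_stable_implies_all[OF assms(3,4)] assms(3)
    by (auto simp: inf_torsionfree_objects_def torsionfree_objects_def)
  show "weakly_gorenstein A"
    unfolding weakly_gorenstein_def
    using gorenstein_projective_left_perp[OF assms(2)]
      left_perp_gorenstein_projective[OF assms(2-4)] by (rule equalityI)
qed

end
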